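(* Let $L$ be a nonsolvable Lie algebra of dimension $4$ over a finite field $k$ of characteristic $p$. If $p=2$, then either $L\cong W(1;\underline 2)$, or $L\cong W(1;\underline 2)^{(1)}\oplus C(L)$ is the direct sum of an ideal isomorphic to $W(1;\underline 2)^{(1)}$ and its center $C(L)$. If $p\ge 3$, then $L\cong \mathfrak{gl}(2,k)$.
   Context: Notation over a field $k$ of characteristic $p>0$: for an integer $n\ge 1$, $\mathcal O(1;\underline n)$ is the commutative associative unital $k$-algebra with basis $x^{(0)}=1,\ x=x^{(1)},\ x^{(2)},\ldots,x^{(p^n-1)}$ and product $x^{(r)}x^{(s)}=\binom{r+s}{r}x^{(r+s)}$ (read as $0$ if $r+s\ge p^n$). The derivation $\partial$ of $\mathcal O(1;\underline n)$ is given by $\partial(1)=0$, $\partial(x^{(r)})=x^{(r-1)}$ for $r\ge 1$. The Witt type Lie algebra is $W(1;\underline n)=\{f\partial\mid f\in\mathcal O(1;\underline n)\}$ with $[f\partial,g\partial]=(f\partial(g)-g\partial(f))\partial$; it has dimension $p^n$. For a Lie algebra $L$, $L^{(1)}=[L,L]$ and $C(L)$ is the center of $L$. For $p=2$, $W(1;\underline 2)$ is 4-dimensional with basis $\partial, x\partial, x^{(2)}\partial, x^{(3)}\partial$, and $W(1;\underline 2)^{(1)}$ is 3-dimensional with basis $\partial,\ x\partial,\ x^{(2)}\partial$. *)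

theory Defs
  imports "HOL-Analysis.Analysis" "HOL-Library.Function_Algebras"
begin

text \<open>
  A Lie algebra lives on a subset of an ambient vector space, so that subalgebras and ideals
  are obtained by shrinking the carrier.  Addition is that of the ambient type; the bracket is
  only constrained on the carrier.
\<close>

record ('k, 'v) lie_alg =
  lie_carrier :: "'v set"
  lie_scale :: "'k \<Rightarrow> 'v \<Rightarrow> 'v"
  lie_bracket :: "'v \<Rightarrow> 'v \<Rightarrow> 'v"

locale lie_algebra = vector_space "lie_scale L"
  for L :: "('k::field, 'v::ab_group_add) lie_alg" +
  assumes subspace_carrier: "subspace (lie_carrier L)"
    and bracket_closed:
      "\<lbrakk>x \<in> lie_carrier L; y \<in> lie_carrier L\<rbrakk> \<Longrightarrow> lie_bracket L x y \<in> lie_carrier L"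
    and bracket_add_left:
      "\<lbrakk>x \<in> lie_carrier L; y \<in> lie_carrier L; z \<in> lie_carrier L\<rbrakk>
        \<Longrightarrow> lie_bracket L (x + y) z = lie_bracket L x z + lie_bracket L y z"
    and bracket_add_right:
      "\<lbrakk>x \<in> lie_carrier L; y \<in> lie_carrier L; z \<in> lie_carrier L\<rbrakk>
        \<Longrightarrow> lie_bracket L x (y + z) = lie_bracket L x y + lie_bracket L x z"
    and bracket_scale_left:
      "\<lbrakk>x \<in> lie_carrier L; y \<in> lie_carrier L\<rbrakk>
        \<Longrightarrow> lie_bracket L (lie_scale L c x) y = lie_scale L c (lie_bracket L x y)"
    and bracket_scale_right:
      "\<lbrakk>x \<in> lie_carrier L; y \<in> lie_carrier L\<rbrakk>
        \<Longrightarrow> lie_bracket L x (lie_scale L c y) = lie_scale L c (lie_bracket L x y)"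
    and bracket_self: "x \<in> lie_carrier L \<Longrightarrow> lie_bracket L x x = 0"
    and jacobi:
      "\<lbrakk>x \<in> lie_carrier L; y \<in> lie_carrier L; z \<in> lie_carrier L\<rbrakk>
        \<Longrightarrow> lie_bracket L x (lie_bracket L y z) + lie_bracket L y (lie_bracket L z x)
            + lie_bracket L z (lie_bracket L x y) = 0"

definition lie_dim :: "('k::field, 'v::ab_group_add) lie_alg \<Rightarrow> nat" where
  "lie_dim L = vector_space.dim (lie_scale L) (lie_carrier L)"

definition lie_isomorphic ::
    "('k::field, 'v::ab_group_add) lie_alg \<Rightarrow> ('k, 'w::ab_group_add) lie_alg \<Rightarrow> bool" where
  "lie_isomorphic L M \<longleftrightarrow>
    (\<exists>f. bij_betw f (lie_carrier L) (lie_carrier M) \<and>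
      (\<forall>x\<in>lie_carrier L. \<forall>y\<in>lie_carrier L. f (x + y) = f x + f y) \<and>
      (\<forall>c. \<forall>x\<in>lie_carrier L. f (lie_scale L c x) = lie_scale M c (f x)) \<and>
      (\<forall>x\<in>lie_carrier L. \<forall>y\<in>lie_carrier L.
        f (lie_bracket L x y) = lie_bracket M (f x) (f y)))"

definition lie_restrict ::
    "('k, 'v) lie_alg \<Rightarrow> 'v set \<Rightarrow> ('k, 'v) lie_alg" where
  "lie_restrict L A = L\<lparr>lie_carrier := A\<rparr>"

definition lie_derived :: "('k::field, 'v::ab_group_add) lie_alg \<Rightarrow> ('k, 'v) lie_alg" where
  "lie_derived L = lie_restrict L
    (module.span (lie_scale L)
      {lie_bracket L x y |x y. x \<in> lie_carrier L \<and> y \<in> lie_carrier L})"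

definition lie_solvable :: "('k::field, 'v::ab_group_add) lie_alg \<Rightarrow> bool" where
  "lie_solvable L \<longleftrightarrow> (\<exists>n. lie_carrier ((lie_derived ^^ n) L) = {0})"

definition lie_center :: "('k, 'v::zero) lie_alg \<Rightarrow> 'v set" where
  "lie_center L = {x \<in> lie_carrier L. \<forall>y\<in>lie_carrier L. lie_bracket L x y = 0}"

definition lie_ideal :: "('k::field, 'v::ab_group_add) lie_alg \<Rightarrow> 'v set \<Rightarrow> bool" where
  "lie_ideal L I \<longleftrightarrow> I \<subseteq> lie_carrier L \<and> module.subspace (lie_scale L) I \<and>
    (\<forall>x\<in>lie_carrier L. \<forall>y\<in>I. lie_bracket L x y \<in> I)"

definition lie_direct_sum ::
    "('k::field, 'v::ab_group_add) lie_alg \<Rightarrow> 'v set \<Rightarrow> 'v set \<Rightarrow> bool" where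
  "lie_direct_sum L I J \<longleftrightarrow> lie_ideal L I \<and> lie_ideal L J \<and> I \<inter> J = {0} \<and>
    lie_carrier L = {x + y |x y. x \<in> I \<and> y \<in> J}"

text \<open>
  The divided power algebra \<open>O(1;n)\<close>: the element \<open>\<Sum>r. a\<^sub>r x\<^sup>(\<^sup>r\<^sup>)\<close> is encoded by its
  coefficient function \<open>\<lambda>r. a\<^sub>r\<close>, supported on \<open>r < p ^ n\<close> with \<open>p = CHAR('k)\<close>.
  The pointwise product from \<^theory>\<open>HOL-Library.Function_Algebras\<close> is not the product
  of \<open>O(1;n)\<close>; only the pointwise additive structure is used.
\<close>

definition dp_carrier :: "nat \<Rightarrow> (nat \<Rightarrow> 'k::field) set" where
  "dp_carrier n = {f. \<forall>r. r \<ge> CHAR('k) ^ n \<longrightarrow> f r = 0}"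

definition dp_basis :: "nat \<Rightarrow> nat \<Rightarrow> 'k::field" where
  "dp_basis r = (\<lambda>m. if m = r then 1 else 0)"

definition dp_mult :: "nat \<Rightarrow> (nat \<Rightarrow> 'k::field) \<Rightarrow> (nat \<Rightarrow> 'k) \<Rightarrow> nat \<Rightarrow> 'k" where
  "dp_mult n f g = (\<lambda>m. if m < CHAR('k) ^ n
     then \<Sum>r\<le>m. of_nat (m choose r) * f r * g (m - r) else 0)"

definition dp_deriv :: "(nat \<Rightarrow> 'k::field) \<Rightarrow> nat \<Rightarrow> 'k" where
  "dp_deriv f = (\<lambda>m. f (Suc m))"

lemma dp_mult_basis:
  "dp_mult n (dp_basis r) (dp_basis s :: nat \<Rightarrow> 'k::field) =
    (if r + s < CHAR('k) ^ n then (\<lambda>m. of_nat ((r + s) choose r) * dp_basis (r + s) m) else 0)"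
proof
  fix m
  have "(\<Sum>i\<le>m. of_nat (m choose i) * dp_basis r i * (dp_basis s (m - i) :: 'k)) =
        (\<Sum>i\<le>m. if i = r then of_nat (m choose r) * dp_basis s (m - r) else 0)"
    by (intro sum.cong) (auto simp: dp_basis_def)
  also have "\<dots> = (if m = r + s then of_nat (m choose r) else 0)"
    by (auto simp: dp_basis_def)
  finally show "dp_mult n (dp_basis r) (dp_basis s :: nat \<Rightarrow> 'k) m =
    (if r + s < CHAR('k) ^ n
      then (\<lambda>m. of_nat ((r + s) choose r) * dp_basis (r + s) m) else 0) m"
    by (auto simp: dp_mult_def dp_basis_def)
qed

lemma dp_deriv_basis:
  "dp_deriv (dp_basis 0) = (0 :: nat \<Rightarrow> 'k::field)"
  "dp_deriv (dp_basis (Suc r)) = (dp_basis r :: nat \<Rightarrow> 'k::field)"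
  by (auto simp: dp_deriv_def dp_basis_def fun_eq_iff)

text \<open>
  In \<open>W(1;n)\<close> the derivation \<open>f\<partial>\<close> is represented by \<open>f\<close>.
\<close>

definition witt :: "nat \<Rightarrow> ('k::field, nat \<Rightarrow> 'k) lie_alg" where
  "witt n = \<lparr>lie_carrier = dp_carrier n,
     lie_scale = (\<lambda>c f r. c * f r),
     lie_bracket = (\<lambda>f g. dp_mult n f (dp_deriv g) - dp_mult n g (dp_deriv f))\<rparr>"

definition gl2 :: "('k::field, 'k ^ 2 ^ 2) lie_alg" where
  "gl2 = \<lparr>lie_carrier = UNIV,
     lie_scale = (\<lambda>c. map_matrix ((*) c)),
     lie_bracket = (\<lambda>A B. A ** B - B ** A)\<rparr>"

end

theory Submission
  imports Defs
begin

text \<open>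
  The derived series of a nonsolvable Lie algebra \<open>L\<close> of dimension four stops at a perfect algebra,
  which has dimension at least three. The key point is that dimension four is impossible for a
  perfect algebra, over any field (\<open>not_perfect_if_dim_4\<close>). Indeed, in terms of the
  Chevalley-Eilenberg differential \<open>d\<close>, a perfect algebra is unimodular, so every form
  \<open>d\<phi> \<and> d\<psi> = d (\<phi> \<and> d\<psi>)\<close> of top degree vanishes. The forms \<open>d\<phi>\<close> are therefore a totally isotropic
  subspace of the six-dimensional space of \<open>2\<close>-forms, of dimension at most three, whereas
  \<open>d\<close> is injective on functionals of a perfect algebra. Hence \<open>D = [L, L]\<close> is a perfect ideal of
  dimension three (\<open>derived_perfect_of_dim_3\<close>).

  The bracket of a perfect algebra of dimension three is a nondegenerate bilinear form on the dual
  space, which is symmetric by the Jacobi identity (\<open>structure_matrix_symmetric\<close>). Classifying such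
  forms over a finite field gives a basis \<open>e, h, f\<close> with \<open>[e, f] = h\<close>, \<open>[h, e] = \<tau> e\<close> and
  \<open>[h, f] = - \<tau> f\<close>. In odd characteristic \<open>\<tau> = 2\<close>; here a binary quadratic form has to represent
  one, which it does by counting squares (\<open>obtain_sl2_triple\<close>). In characteristic two
  \<open>\<tau> = 1\<close>, and only square roots are needed (\<open>obtain_triple_char_2\<close>).

  An element outside \<open>D\<close> acts on \<open>D\<close> by a derivation. In odd characteristic all derivations of \<open>D\<close> are
  inner, so \<open>D\<close> has a central complement and \<open>L\<close> is \<open>gl(2, k)\<close>. In characteristic two there
  are two further derivations modulo the inner ones, \<open>(ad e)\<^sup>2\<close> and \<open>(ad f)\<^sup>2\<close>
  (\<open>obtain_reduced_derivation\<close>). If none of them is involved, then \<open>L\<close> is the direct sum of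
  \<open>D\<close> and its center. Otherwise, modulo inner derivations, a nonzero combination of them is again a
  square \<open>(ad f')\<^sup>2\<close>, because the field is perfect, and after a change of the basis the
  relations of \<open>W(1; 2)\<close> appear (\<open>obtain_outer_square_derivation\<close>).
\<close>

section \<open>Linear algebra in small dimension\<close>

context vector_space
begin

abbreviation (input) scaling (infixr "\<cdot>" 75) where "scaling \<equiv> scale"

lemma in_span_singleton: "x \<in> span {a} \<longleftrightarrow> (\<exists>\<alpha>. x = \<alpha> \<cdot> a)"
  by (auto simp: span_singleton)

lemma in_span_insert_iff: "x \<in> span (insert a S) \<longleftrightarrow> (\<exists>\<alpha>. \<exists>y\<in>span S. x = \<alpha> \<cdot> a + y)"
  unfolding span_breakdown_eq by (metis add_diff_cancel_left' diff_add_cancel add.commute)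

lemma in_span2: "x \<in> span {a, b} \<longleftrightarrow> (\<exists>\<alpha> \<beta>. x = \<alpha> \<cdot> a + \<beta> \<cdot> b)"
  unfolding in_span_insert_iff[of _ a] Bex_def in_span_singleton by blast

lemma in_span3: "x \<in> span {a, b, c} \<longleftrightarrow> (\<exists>\<alpha> \<beta> \<gamma>. x = \<alpha> \<cdot> a + \<beta> \<cdot> b + \<gamma> \<cdot> c)"
  unfolding in_span_insert_iff[of _ a] Bex_def in_span2 by (simp add: add.assoc) blast

lemma in_span4:
  "x \<in> span {a, b, c, d} \<longleftrightarrow> (\<exists>\<alpha> \<beta> \<gamma> \<delta>. x = \<alpha> \<cdot> a + \<beta> \<cdot> b + \<gamma> \<cdot> c + \<delta> \<cdot> d)"
  unfolding in_span_insert_iff[of _ a] Bex_def in_span3 by (simp add: add.assoc) blast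

lemma span_comb:
  "a \<in> span S \<Longrightarrow> b \<in> span S \<Longrightarrow> \<alpha> \<cdot> a + \<beta> \<cdot> b \<in> span S"
  by (simp add: span_add span_scale)

text \<open>
  A finite family that spans a space of at least its own size is linearly independent. With the
  lemmas below, a change of basis only needs a verification that the new vectors span.
\<close>

lemma coeff_zero_of_dim:
  assumes "finite S" and dim: "card S < dim (span (insert a S))"
    and "\<alpha> \<cdot> a + y = 0" and y: "y \<in> span S"
  shows "\<alpha> = 0"
proof (rule ccontr)
  assume "\<alpha> \<noteq> 0"
  then have "a = (- inverse \<alpha>) \<cdot> y"
  proof -
    have "\<alpha> \<cdot> a = - y" using assms(3) by (simp add: eq_neg_iff_add_eq_0)
    then have "inverse \<alpha> \<cdot> (\<alpha> \<cdot> a) = inverse \<alpha> \<cdot> (- y)" by simp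
    then show ?thesis using \<open>\<alpha> \<noteq> 0\<close> by simp
  qed
  then have "a \<in> span S" using y span_scale by blast
  then have "span (insert a S) \<subseteq> span S"
    by (simp add: span_redundant)
  then have "dim (span (insert a S)) \<le> card S"
    using dim_le_card assms(1) by blast
  then show False using dim by simp
qed

lemma independent3_of_dim:
  assumes "3 \<le> dim (span {a, b, c})" and "\<alpha> \<cdot> a + \<beta> \<cdot> b + \<gamma> \<cdot> c = 0"
  shows "\<alpha> = 0" "\<beta> = 0" "\<gamma> = 0"
proof -
  have *: "\<alpha> = 0" if "3 \<le> dim (span {a, b, c})" "\<alpha> \<cdot> a + (\<beta> \<cdot> b + \<gamma> \<cdot> c) = 0"
    for a b c \<alpha> \<beta> \<gamma>
    using coeff_zero_of_dim[of "{b, c}" a \<alpha> "\<beta> \<cdot> b + \<gamma> \<cdot> c"] that card_insert_le_m1[of 2 "{c}" b]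
    by (auto simp: in_span2)
  show "\<alpha> = 0" using *[of a b c] assms by (simp add: add.assoc)
  show "\<beta> = 0" using *[of b a c \<beta> \<alpha> \<gamma>] assms by (simp add: insert_commute ac_simps)
  show "\<gamma> = 0" using *[of c a b \<gamma> \<alpha> \<beta>] assms by (simp add: insert_commute ac_simps)
qed

lemma independent4_of_dim:
  assumes "4 \<le> dim (span {a, b, c, d})" and "\<alpha> \<cdot> a + \<beta> \<cdot> b + \<gamma> \<cdot> c + \<delta> \<cdot> d = 0"
  shows "\<alpha> = 0" "\<beta> = 0" "\<gamma> = 0" "\<delta> = 0"
proof -
  have *: "\<alpha> = 0" if "4 \<le> dim (span {a, b, c, d})" "\<alpha> \<cdot> a + (\<beta> \<cdot> b + \<gamma> \<cdot> c + \<delta> \<cdot> d) = 0"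
    for a b c d \<alpha> \<beta> \<gamma> \<delta>
  proof -
    have "card {b, c, d} \<le> 3" by (simp add: card_insert_if)
    then show ?thesis
      using coeff_zero_of_dim[of "{b, c, d}" a \<alpha> "\<beta> \<cdot> b + \<gamma> \<cdot> c + \<delta> \<cdot> d"] that
      by (auto simp: in_span3)
  qed
  show "\<alpha> = 0" using *[of a b c d] assms by (simp add: add.assoc)
  show "\<beta> = 0" using *[of b a c d \<beta> \<alpha> \<gamma> \<delta>] assms by (simp add: insert_commute ac_simps)
  show "\<gamma> = 0" using *[of c a b d \<gamma> \<alpha> \<beta> \<delta>] assms by (simp add: insert_commute ac_simps)
  show "\<delta> = 0" using *[of d a b c \<delta> \<alpha> \<beta> \<gamma>] assms by (simp add: insert_commute ac_simps)
qed

lemma coeffs_eq3_of_dim: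
  assumes "3 \<le> dim (span {a, b, c})"
    and "\<alpha> \<cdot> a + \<beta> \<cdot> b + \<gamma> \<cdot> c = \<alpha>' \<cdot> a + \<beta>' \<cdot> b + \<gamma>' \<cdot> c"
  shows "\<alpha> = \<alpha>'" "\<beta> = \<beta>'" "\<gamma> = \<gamma>'"
proof -
  have "(\<alpha> - \<alpha>') \<cdot> a + (\<beta> - \<beta>') \<cdot> b + (\<gamma> - \<gamma>') \<cdot> c = 0"
    using assms(2) by (simp add: scale_left_diff_distrib algebra_simps)
  from independent3_of_dim[OF assms(1) this] show "\<alpha> = \<alpha>'" "\<beta> = \<beta>'" "\<gamma> = \<gamma>'"
    by simp_all
qed

lemma char_2_simps:
  assumes "(2 :: 'a) = 0"
  shows "- (x :: 'b) = x" "x + x = 0" "x + (x + y) = y" "- (\<alpha> :: 'a) = \<alpha>" "\<alpha> + \<alpha> = 0"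
    "\<alpha> + (\<alpha> + \<beta>) = \<beta>"
proof -
  have "\<alpha> + \<alpha> = 0" for \<alpha> :: 'a using assms by (metis mult_2 mult_zero_left)
  note scalar = this
  show "\<alpha> + \<alpha> = 0" by (rule scalar)
  then show "- \<alpha> = \<alpha>" by (rule minus_unique)
  show "\<alpha> + (\<alpha> + \<beta>) = \<beta>" by (simp only: add.assoc[symmetric] scalar add_0)
  have "x + x = (1 + 1) \<cdot> x" by (simp only: scale_left_distrib scale_one)
  then show "x + x = 0" by (simp only: scalar scale_zero_left)
  then show "- x = x" by (rule minus_unique)
  show "x + (x + y) = y" by (simp only: add.assoc[symmetric] \<open>x + x = 0\<close> add_0)
qed

lemma obtain_basis:
  assumes "subspace V" and "dim V = n" and "0 < n"
  obtains B where "finite B" "card B = n" "span B = V" "independent B"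
proof -
  obtain B where B: "B \<subseteq> V" "independent B" "V \<subseteq> span B" "card B = dim V"
    by (rule basis_exists)
  with assms that show ?thesis
    by (metis card_ge_0_finite span_minimal subset_antisym)
qed

lemma obtain_basis3:
  assumes "subspace V" and "dim V = 3"
  obtains a b c where "span {a, b, c} = V"
proof -
  obtain B where B: "card B = 3" "span B = V"
    by (rule obtain_basis[OF assms]) simp_all
  then obtain a b c where "B = {a, b, c}" by (metis card_3_iff)
  then show ?thesis using that B(2) by blast
qed

text \<open>
  An infinite-dimensional space has dimension zero by convention, so that a positive dimension of
  \<open>W\<close> provides a finite basis.
\<close>

lemma dim_mono_finite:
  assumes "V \<subseteq> W" and "0 < dim W"
  shows "dim V \<le> dim W"
proof -
  obtain B where "W \<subseteq> span B" "card B = dim W" by (rule basis_exists)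
  then show ?thesis
    using assms dim_le_card[of V B] card_ge_0_finite by (metis order_trans)
qed

lemma subspace_eq_of_dim_le:
  assumes "subspace V" "subspace W" "V \<subseteq> W" "dim W \<le> dim V" "0 < dim W"
  shows "V = W"
proof (rule ccontr)
  assume "V \<noteq> W"
  then obtain x where x: "x \<in> W" "x \<notin> V" using assms(3) by blast
  obtain B where B: "B \<subseteq> V" "independent B" "V \<subseteq> span B" "card B = dim V"
    by (rule basis_exists)
  have V: "span B = V" using B assms(1) by (simp add: span_subspace)
  have "finite B" using B(4) assms(4,5) card_ge_0_finite by (metis order_less_le_trans)
  have ind: "independent (insert x B)" using x V B(2) by (simp add: independent_insertI)
  have "x \<notin> B" using x B(1) by blast
  have "span (insert x B) \<subseteq> W"
    using x B(1) assms(2,3) by (intro span_minimal) auto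
  then have "dim (span (insert x B)) \<le> dim W"
    using dim_mono_finite assms(5) by blast
  moreover have "dim (span (insert x B)) = Suc (card B)"
    using dim_span_eq_card_independent[OF ind] \<open>finite B\<close> \<open>x \<notin> B\<close> by simp
  ultimately show False using assms(4) B(4) by simp
qed

end

section \<open>Brackets and the derived algebra\<close>

context lie_algebra
begin

abbreviation scl (infixr "\<cdot>" 75) where "scl \<equiv> lie_scale L"
abbreviation brk (infixl "\<star>" 70) where "brk \<equiv> lie_bracket L"
abbreviation G where "G \<equiv> lie_carrier L"
abbreviation D where "D \<equiv> lie_carrier (lie_derived L)"

lemma carrier_closed [simp]:
  "0 \<in> G" "x \<in> G \<Longrightarrow> y \<in> G \<Longrightarrow> x + y \<in> G" "x \<in> G \<Longrightarrow> c \<cdot> x \<in> G"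
  "x \<in> G \<Longrightarrow> y \<in> G \<Longrightarrow> x - y \<in> G" "x \<in> G \<Longrightarrow> - x \<in> G" "x \<in> G \<Longrightarrow> y \<in> G \<Longrightarrow> x \<star> y \<in> G"
  using subspace_carrier bracket_closed
  by (simp_all add: subspace_0 subspace_add subspace_scale subspace_diff subspace_neg)

lemmas bracket_linear = bracket_add_left bracket_add_right bracket_scale_left bracket_scale_right

lemma bracket_anti:
  assumes "x \<in> G" "y \<in> G"
  shows "y \<star> x = - (x \<star> y)"
proof -
  have "0 = (x + y) \<star> (x + y)" using assms by (simp add: bracket_self)
  also have "\<dots> = x \<star> (x + y) + y \<star> (x + y)" using assms by (simp add: bracket_add_left)
  finally have "x \<star> y + y \<star> x = 0"
    using assms by (simp add: bracket_add_right bracket_self)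
  then show ?thesis by (simp add: eq_neg_iff_add_eq_0 add.commute)
qed

lemma bracket_zero [simp]:
  assumes "x \<in> G"
  shows "x \<star> 0 = 0" "0 \<star> x = 0"
  using bracket_scale_right[of x x 0] bracket_scale_left[of x x 0] assms by simp_all

lemma bracket_minus:
  assumes "x \<in> G" "y \<in> G"
  shows "x \<star> (- y) = - (x \<star> y)" "(- x) \<star> y = - (x \<star> y)"
  using bracket_scale_right[of x y "- 1"] bracket_scale_left[of x y "- 1"] assms by simp_all

lemma bracket_diff:
  assumes "x \<in> G" "y \<in> G" "z \<in> G"
  shows "x \<star> (y - z) = x \<star> y - x \<star> z" "(x - y) \<star> z = x \<star> z - y \<star> z"
  using bracket_add_right[of x y "- z"] bracket_add_left[of x "- y" z] assms
  by (simp_all add: bracket_minus)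

lemma bracket_comb3:
  assumes "u \<in> G" "v \<in> G" "w \<in> G"
  shows "(\<alpha> \<cdot> u + \<beta> \<cdot> v + \<gamma> \<cdot> w) \<star> (\<alpha>' \<cdot> u + \<beta>' \<cdot> v + \<gamma>' \<cdot> w) =
    (\<alpha> * \<beta>' - \<beta> * \<alpha>') \<cdot> (u \<star> v) + (\<beta> * \<gamma>' - \<gamma> * \<beta>') \<cdot> (v \<star> w)
      + (\<gamma> * \<alpha>' - \<alpha> * \<gamma>') \<cdot> (w \<star> u)"
  using assms bracket_anti[of u v] bracket_anti[of v w] bracket_anti[of w u]
  by (simp add: bracket_linear bracket_self scale_left_diff_distrib scale_right_distrib
      scale_right_diff_distrib ac_simps)

lemma bracket_comb4:
  assumes "u \<in> G" "v \<in> G" "w \<in> G" "t \<in> G"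
  shows "(\<alpha> \<cdot> u + \<beta> \<cdot> v + \<gamma> \<cdot> w + \<delta> \<cdot> t) \<star> (\<alpha>' \<cdot> u + \<beta>' \<cdot> v + \<gamma>' \<cdot> w + \<delta>' \<cdot> t) =
    (\<alpha> * \<beta>' - \<beta> * \<alpha>') \<cdot> (u \<star> v) + (\<beta> * \<gamma>' - \<gamma> * \<beta>') \<cdot> (v \<star> w)
      + (\<gamma> * \<alpha>' - \<alpha> * \<gamma>') \<cdot> (w \<star> u)
      + ((\<delta> * \<alpha>' - \<alpha> * \<delta>') \<cdot> (t \<star> u) + (\<delta> * \<beta>' - \<beta> * \<delta>') \<cdot> (t \<star> v)
      + (\<delta> * \<gamma>' - \<gamma> * \<delta>') \<cdot> (t \<star> w))"
proof -
  let ?x = "\<alpha> \<cdot> u + \<beta> \<cdot> v + \<gamma> \<cdot> w" and ?y = "\<alpha>' \<cdot> u + \<beta>' \<cdot> v + \<gamma>' \<cdot> w"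
  have "(x + \<delta> \<cdot> t) \<star> (y + \<delta>' \<cdot> t) = x \<star> y + (\<delta> \<cdot> (t \<star> y) - \<delta>' \<cdot> (t \<star> x))"
    if "x \<in> G" "y \<in> G" for x y
    using assms that bracket_anti[of t x]
    by (simp add: bracket_linear bracket_self scale_right_distrib)
  from this[of ?x ?y]
  have "(?x + \<delta> \<cdot> t) \<star> (?y + \<delta>' \<cdot> t) = ?x \<star> ?y + (\<delta> \<cdot> (t \<star> ?y) - \<delta>' \<cdot> (t \<star> ?x))"
    using assms by simp
  moreover have "\<delta> \<cdot> (t \<star> ?y) - \<delta>' \<cdot> (t \<star> ?x) =
      (\<delta> * \<alpha>' - \<alpha> * \<delta>') \<cdot> (t \<star> u) + (\<delta> * \<beta>' - \<beta> * \<delta>') \<cdot> (t \<star> v)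
      + (\<delta> * \<gamma>' - \<gamma> * \<delta>') \<cdot> (t \<star> w)"
    using assms by (simp add: bracket_linear scale_left_diff_distrib scale_right_distrib
      scale_right_diff_distrib ac_simps)
  ultimately show ?thesis by (simp only: bracket_comb3[OF assms(1-3)])
qed

lemma D_def: "D = span {x \<star> y |x y. x \<in> G \<and> y \<in> G}"
  by (simp add: lie_derived_def lie_restrict_def)

lemma bracket_in_D: "x \<in> G \<Longrightarrow> y \<in> G \<Longrightarrow> x \<star> y \<in> D"
  unfolding D_def by (rule span_base) blast

lemma subspace_D: "subspace D"
  unfolding D_def by simp

lemma D_subset: "D \<subseteq> G"
  unfolding D_def by (rule span_minimal) (auto simp: subspace_carrier)

lemma D_in_carrier: "x \<in> D \<Longrightarrow> x \<in> G"
  using D_subset by blast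

lemma derived_simps [simp]:
  "lie_scale (lie_derived L) = lie_scale L" "lie_bracket (lie_derived L) = lie_bracket L"
  by (simp_all add: lie_derived_def lie_restrict_def)

lemma lie_algebra_derived: "lie_algebra (lie_derived L)"
  by unfold_locales
    (simp_all add: D_in_carrier subspace_D scale_right_distrib scale_left_distrib bracket_in_D bracket_linear
      bracket_self jacobi)

lemma D_eq_span:
  assumes G: "G = span S"
  shows "D = span {x \<star> y |x y. x \<in> S \<and> y \<in> S}" (is "_ = span ?B")
proof (rule antisym)
  have S: "S \<subseteq> G" using G span_superset by blast
  have left: "x \<in> G \<and> x \<star> y \<in> span ?B" if "x \<in> span S" and y: "y \<in> S" for x y
    using that(1)
  proof (induction rule: span_induct_alt)
    case base
    then show ?case using y S by (auto simp: span_zero)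
  next
    case (step c x z)
    have "x \<star> y \<in> span ?B" using step(1) y by (auto intro: span_base)
    moreover have "x \<in> G" "y \<in> G" using S step(1) y by auto
    ultimately show ?case using step by (simp add: bracket_linear span_add span_scale)
  qed
  have both: "y \<in> G \<and> x \<star> y \<in> span ?B" if x: "x \<in> span S" and "y \<in> span S" for x y
    using that(2)
  proof (induction rule: span_induct_alt)
    case base
    then show ?case using x G by (auto simp: span_zero)
  next
    case (step c y z)
    then show ?case using left[OF x] S by (auto simp: bracket_linear span_add span_scale)
  qed
  show "D \<subseteq> span ?B"
    unfolding D_def by (rule span_minimal) (use both G in auto)
  show "span ?B \<subseteq> D"
    by (rule span_minimal) (use S bracket_in_D subspace_D in blast)+
qed

end

section \<open>No four-dimensional Lie algebra is perfect\<close>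

context vector_space
begin

lemma obtain_functional_vanishing_at_two:
  assumes V: "subspace V" "3 \<le> dim V" and pq: "p \<in> V" "q \<in> V"
  obtains \<phi> x where "\<And>x y. x \<in> V \<Longrightarrow> y \<in> V \<Longrightarrow> \<phi> (x + y) = \<phi> x + \<phi> y"
    and "\<And>c x. x \<in> V \<Longrightarrow> \<phi> (c \<cdot> x) = c * \<phi> x"
    and "\<phi> p = 0" "\<phi> q = 0" and "x \<in> V" "\<phi> x \<noteq> 0"
proof -
  obtain B where B: "B \<subseteq> {p, q}" "independent B" "{p, q} \<subseteq> span B"
    by (rule maximal_independent_subset)
  obtain C where C: "B \<subseteq> C" "C \<subseteq> V" "independent C" "V \<subseteq> span C"
    using maximal_independent_subset_extend[of B V] B pq by blast
  have span_C: "span C = V" using C V span_subspace by blast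
  have "card C = dim V" using C basis_card_eq_dim by blast
  moreover have "card B \<le> 2"
    using card_mono[OF _ B(1)] by (auto simp: card_insert_if split: if_splits)
  ultimately have "B \<noteq> C" using V(2) by auto
  then obtain c where c: "c \<in> C" "c \<notin> B" using C(1) by blast
  let ?\<phi> = "\<lambda>x. representation C x c"
  have vanish: "?\<phi> y = 0" if "y \<in> {p, q}" for y
  proof -
    have "representation C y = representation B y"
      using that B C representation_extend by blast
    then show ?thesis using c(2) representation_ne_zero by metis
  qed
  show ?thesis
    by (rule that[of ?\<phi> c])
      (use C c V vanish in \<open>auto simp: span_C representation_add representation_scale
        representation_basis\<close>)
qed

end

context lie_algebra
begin

lemma jacobi_left:
  assumes "x \<in> G" "y \<in> G" "z \<in> G"
  shows "(x \<star> y) \<star> z = x \<star> (y \<star> z) - y \<star> (x \<star> z)"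
proof -
  have "x \<star> (y \<star> z) + y \<star> (z \<star> x) + z \<star> (x \<star> y) = 0" using assms by (rule jacobi)
  moreover have "z \<star> (x \<star> y) = - ((x \<star> y) \<star> z)" "y \<star> (z \<star> x) = - (y \<star> (x \<star> z))"
    using assms bracket_anti[of "x \<star> y" z] bracket_anti[of x z] by (simp_all add: bracket_minus)
  ultimately show ?thesis by (simp add: algebra_simps)
qed

lemma bracket_sum:
  assumes "finite B" "B \<subseteq> G" "x \<in> G"
  shows "x \<star> (\<Sum>b\<in>B. f b \<cdot> b) = (\<Sum>b\<in>B. f b \<cdot> (x \<star> b))"
proof -
  have "(\<Sum>b\<in>B. f b \<cdot> b) \<in> G \<and> ?thesis"
    using assms(1,2) by (induction rule: finite_induct) (simp_all add: assms(3) bracket_linear)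
  then show ?thesis by blast
qed

text \<open>
  The trace of an inner derivation vanishes on brackets, because the adjoint representation turns
  brackets into commutators of endomorphisms.
\<close>

lemma trace_ad_bracket:
  assumes B: "finite B" "independent B" "span B = G" and x: "x \<in> G" and y: "y \<in> G"
  shows "(\<Sum>b\<in>B. representation B ((x \<star> y) \<star> b) b) = 0"
proof -
  let ?r = "representation B"
  have BG: "B \<subseteq> G" using B(3) span_superset by blast
  have comp: "?r (x \<star> (y \<star> b)) b = (\<Sum>b'\<in>B. ?r (y \<star> b) b' * ?r (x \<star> b') b)"
    if "b \<in> B" "x \<in> G" "y \<in> G" for x y b
  proof -
    have yb: "y \<star> b \<in> span B" using that BG B(3) by auto
    have "x \<star> (y \<star> b) = x \<star> (\<Sum>b'\<in>B. ?r (y \<star> b) b' \<cdot> b')"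
      using sum_representation_eq[OF B(2) yb B(1)] by simp
    also have "\<dots> = (\<Sum>b'\<in>B. ?r (y \<star> b) b' \<cdot> (x \<star> b'))"
      using bracket_sum B(1) BG that by blast
    finally show ?thesis
      using BG that B by (auto simp: representation_sum representation_scale subset_iff)
  qed
  have "(\<Sum>b\<in>B. ?r ((x \<star> y) \<star> b) b) = (\<Sum>b\<in>B. ?r (x \<star> (y \<star> b)) b - ?r (y \<star> (x \<star> b)) b)"
    using BG x y by (intro sum.cong) (auto simp: jacobi_left representation_diff B subset_iff)
  also have "\<dots> = (\<Sum>b\<in>B. \<Sum>b'\<in>B. ?r (y \<star> b) b' * ?r (x \<star> b') b)
      - (\<Sum>b\<in>B. \<Sum>b'\<in>B. ?r (x \<star> b) b' * ?r (y \<star> b') b)"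
    using x y by (simp add: sum_subtractf comp)
  also have "(\<Sum>b\<in>B. \<Sum>b'\<in>B. ?r (x \<star> b) b' * ?r (y \<star> b') b) =
      (\<Sum>b\<in>B. \<Sum>b'\<in>B. ?r (y \<star> b) b' * ?r (x \<star> b') b)"
    by (subst sum.swap) (simp add: mult.commute)
  finally show ?thesis by simp
qed

lemma trace_ad_eq_zero_if_perfect:
  assumes B: "finite B" "independent B" "span B = G" and "D = G" and "x \<in> G"
  shows "(\<Sum>b\<in>B. representation B (x \<star> b) b) = 0"
proof -
  have BG: "B \<subseteq> G" using B(3) span_superset by blast
  have "x \<in> span {x \<star> y |x y. x \<in> G \<and> y \<in> G}"
    using assms(4,5) D_def by blast
  then have "x \<in> G \<and> (\<Sum>b\<in>B. representation B (x \<star> b) b) = 0"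
  proof (induction rule: span_induct_alt)
    case base
    then show ?case using BG by (auto intro!: sum.neutral simp: representation_zero subset_iff)
  next
    case (step c x y)
    then obtain u v where x: "x = u \<star> v" "u \<in> G" "v \<in> G" by blast
    then have "x \<in> G" by simp
    have "(\<Sum>b\<in>B. representation B ((c \<cdot> x + y) \<star> b) b) =
        (\<Sum>b\<in>B. c * representation B (x \<star> b) b + representation B (y \<star> b) b)"
      using \<open>x \<in> G\<close> step BG
      by (intro sum.cong)
        (auto simp: bracket_linear representation_add representation_scale B subset_iff)
    also have "\<dots> = 0"
      using step trace_ad_bracket[OF B x(2,3)] x(1)
      by (simp add: sum.distrib flip: sum_distrib_left)
    finally show ?case using \<open>x \<in> G\<close> step by simp
  qed
  then show ?thesis by blast
qed

text \<open>
  The Jacobi identity for \<open>a1, a2, a3\<close>, expanded in the basis: the terms carrying \<open>r4\<close> are three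
  of the six claimed ones, and the vanishing traces of \<open>ad a1\<close>, \<open>ad a2\<close>, \<open>ad a3\<close> turn the
  coefficients of the remaining terms into the other three.
\<close>

lemma bracket_relation_coordinate:
  assumes a: "a1 \<in> G" "a2 \<in> G" "a3 \<in> G" "a4 \<in> G"
    and exp: "\<And>x. x \<in> G \<Longrightarrow> x = r1 x \<cdot> a1 + r2 x \<cdot> a2 + r3 x \<cdot> a3 + r4 x \<cdot> a4"
    and neg: "\<And>x. x \<in> G \<Longrightarrow> r1 (- x) = - r1 x" "\<And>x. x \<in> G \<Longrightarrow> r2 (- x) = - r2 x"
      "\<And>x. x \<in> G \<Longrightarrow> r3 (- x) = - r3 x" 
    and zero: "r1 0 = 0" "r2 0 = 0" "r3 0 = 0"
    and tr: "\<And>x. x \<in> G \<Longrightarrow> r1 (x \<star> a1) + r2 (x \<star> a2) + r3 (x \<star> a3) + r4 (x \<star> a4) = 0"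
  shows "r4 (a1 \<star> a2) \<cdot> (a3 \<star> a4) + r4 (a3 \<star> a1) \<cdot> (a2 \<star> a4) + r4 (a1 \<star> a4) \<cdot> (a2 \<star> a3)
    + r4 (a2 \<star> a3) \<cdot> (a1 \<star> a4) + r4 (a2 \<star> a4) \<cdot> (a3 \<star> a1) + r4 (a3 \<star> a4) \<cdot> (a1 \<star> a2) = 0"
proof -
  have anti: "a2 \<star> a1 = - (a1 \<star> a2)" "a1 \<star> a3 = - (a3 \<star> a1)" "a3 \<star> a2 = - (a2 \<star> a3)"
    using a bracket_anti by blast+
  let ?x = "a2 \<star> a3" and ?y = "a3 \<star> a1" and ?z = "a1 \<star> a2"
  have "a1 \<star> ?x = a1 \<star> (r1 ?x \<cdot> a1 + r2 ?x \<cdot> a2 + r3 ?x \<cdot> a3 + r4 ?x \<cdot> a4)"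
    using exp[of ?x] a by simp
  then have 1: "a1 \<star> ?x = r2 ?x \<cdot> ?z - r3 ?x \<cdot> ?y + r4 ?x \<cdot> (a1 \<star> a4)"
    using a by (simp add: bracket_linear bracket_self anti)
  have "a2 \<star> ?y = a2 \<star> (r1 ?y \<cdot> a1 + r2 ?y \<cdot> a2 + r3 ?y \<cdot> a3 + r4 ?y \<cdot> a4)"
    using exp[of ?y] a by simp
  then have 2: "a2 \<star> ?y = r3 ?y \<cdot> ?x - r1 ?y \<cdot> ?z + r4 ?y \<cdot> (a2 \<star> a4)"
    using a by (simp add: bracket_linear bracket_self anti)
  have "a3 \<star> ?z = a3 \<star> (r1 ?z \<cdot> a1 + r2 ?z \<cdot> a2 + r3 ?z \<cdot> a3 + r4 ?z \<cdot> a4)"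
    using exp[of ?z] a by simp
  then have 3: "a3 \<star> ?z = r1 ?z \<cdot> ?y - r2 ?z \<cdot> ?x + r4 ?z \<cdot> (a3 \<star> a4)"
    using a by (simp add: bracket_linear bracket_self anti)
  have "r2 ?z + - r3 ?y + r4 (a1 \<star> a4) = 0" "- r1 ?z + r3 ?x + r4 (a2 \<star> a4) = 0"
    "r1 ?y + - r2 ?x + r4 (a3 \<star> a4) = 0"
    using tr[of a1] tr[of a2] tr[of a3] a by (simp_all add: bracket_self zero anti neg)
  then have t: "r4 (a1 \<star> a4) = r3 ?y - r2 ?z" "r4 (a2 \<star> a4) = r1 ?z - r3 ?x"
    "r4 (a3 \<star> a4) = r2 ?x - r1 ?y"
    by (simp_all add: algebra_simps eq_neg_iff_add_eq_0)
  have "a1 \<star> ?x + a2 \<star> ?y + a3 \<star> ?z = 0" using a by (intro jacobi)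
  then show ?thesis
    unfolding 1 2 3 t by (simp add: scale_left_diff_distrib algebra_simps)
qed

text \<open>
  In terms of differential forms: for a functional \<open>\<phi>\<close>, the \<open>2\<close>-form \<open>d\<phi>\<close> is, up to sign,
  \<open>\<phi>\<close> composed with the bracket. A perfect Lie algebra is unimodular, so in dimension four
  \<open>d\<close> vanishes on \<open>3\<close>-forms and \<open>d\<phi> \<and> d\<psi> = d (\<phi> \<and> d\<psi>) = 0\<close> for all functionals.
  The relation below is this identity with \<open>\<psi>\<close> left out. The brackets are numbered so that
  \<open>q\<close> and \<open>5 - q\<close> come from complementary pairs of basis vectors; reversing the pair
  \<open>a1, a3\<close> absorbs the sign of the wedge product.
\<close>

lemma bracket_relation:
  assumes "distinct [a1, a2, a3, a4]" and ind: "independent {a1, a2, a3, a4}"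
    and span: "span {a1, a2, a3, a4} = G" and perfect: "D = G"
    and \<phi>: "\<And>x y. x \<in> G \<Longrightarrow> y \<in> G \<Longrightarrow> \<phi> (x + y) = \<phi> x + \<phi> y"
      "\<And>c x. x \<in> G \<Longrightarrow> \<phi> (c \<cdot> x) = c * \<phi> x"
    and b: "b = (!) [a1 \<star> a2, a3 \<star> a1, a1 \<star> a4, a2 \<star> a3, a2 \<star> a4, a3 \<star> a4]"
  shows "(\<Sum>q<6. \<phi> (b (5 - q)) \<cdot> b q) = 0"
proof -
  define B where "B = {a1, a2, a3, a4}"
  define r where "r = (\<lambda>i x. representation B x ([a1, a2, a3, a4] ! i))"
  have B: "finite B" "independent B" "span B = G"
    using ind span by (auto simp: B_def)
  have a [simp]: "a1 \<in> G" "a2 \<in> G" "a3 \<in> G" "a4 \<in> G"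
    unfolding span[symmetric] by (simp_all add: span_base)
  have exp: "x = r 0 x \<cdot> a1 + r 1 x \<cdot> a2 + r 2 x \<cdot> a3 + r 3 x \<cdot> a4" if "x \<in> G" for x
    using sum_representation_eq[OF B(2) _ B(1), of x] that B(3) assms(1)
    by (simp add: B_def r_def add.assoc)
  have tr: "r 0 (x \<star> a1) + r 1 (x \<star> a2) + r 2 (x \<star> a3) + r 3 (x \<star> a4) = 0" if "x \<in> G" for x
    using trace_ad_eq_zero_if_perfect[OF B perfect that] assms(1)
    by (simp add: B_def r_def add.assoc)
  have neg: "r i (- x) = - r i x" if "x \<in> G" for i x
    using that B by (simp add: r_def representation_neg)
  have zero: "r i 0 = 0" for i by (simp add: r_def representation_zero)
  have anti: "a2 \<star> a1 = - (a1 \<star> a2)" "a1 \<star> a3 = - (a3 \<star> a1)" "a3 \<star> a2 = - (a2 \<star> a3)"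
    "a4 \<star> a1 = - (a1 \<star> a4)" "a4 \<star> a2 = - (a2 \<star> a4)" "a4 \<star> a3 = - (a3 \<star> a4)"
    using a bracket_anti by blast+
  define R where "R = (\<lambda>f. f (a1 \<star> a2) \<cdot> (a3 \<star> a4) + f (a3 \<star> a1) \<cdot> (a2 \<star> a4)
    + f (a1 \<star> a4) \<cdot> (a2 \<star> a3) + f (a2 \<star> a3) \<cdot> (a1 \<star> a4) + f (a2 \<star> a4) \<cdot> (a3 \<star> a1)
    + f (a3 \<star> a4) \<cdot> (a1 \<star> a2))"
  \<comment> \<open>Even permutations of the basis preserve the relation and move any coordinate to the last place.\<close>
  have "R (r 3) = 0"
    using bracket_relation_coordinate[of a1 a2 a3 a4 "r 0" "r 1" "r 2" "r 3"] exp tr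
    by (simp add: R_def neg zero ac_simps)
  moreover have "R (r 0) = 0"
    using bracket_relation_coordinate[of a4 a3 a2 a1 "r 3" "r 2" "r 1" "r 0"] exp tr
    by (simp add: R_def neg zero anti ac_simps)
  moreover have "R (r 1) = 0"
    using bracket_relation_coordinate[of a3 a4 a1 a2 "r 2" "r 3" "r 0" "r 1"] exp tr
    by (simp add: R_def neg zero anti ac_simps)
  moreover have "R (r 2) = 0"
    using bracket_relation_coordinate[of a2 a1 a4 a3 "r 1" "r 0" "r 3" "r 2"] exp tr
    by (simp add: R_def neg zero anti ac_simps)
  moreover have "R \<phi> = \<phi> a1 \<cdot> R (r 0) + \<phi> a2 \<cdot> R (r 1) + \<phi> a3 \<cdot> R (r 2) + \<phi> a4 \<cdot> R (r 3)"
  proof -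
    have "\<phi> x = \<phi> a1 * r 0 x + \<phi> a2 * r 1 x + \<phi> a3 * r 2 x + \<phi> a4 * r 3 x" if "x \<in> G" for x
    proof -
      have "\<phi> x = \<phi> (r 0 x \<cdot> a1 + r 1 x \<cdot> a2 + r 2 x \<cdot> a3 + r 3 x \<cdot> a4)"
        using exp[OF that] by simp
      then show ?thesis by (simp add: \<phi> mult.commute)
    qed
    note exp\<phi> = this
    have "R (\<lambda>x. \<phi> a1 * r 0 x + \<phi> a2 * r 1 x + \<phi> a3 * r 2 x + \<phi> a4 * r 3 x) =
      \<phi> a1 \<cdot> R (r 0) + \<phi> a2 \<cdot> R (r 1) + \<phi> a3 \<cdot> R (r 2) + \<phi> a4 \<cdot> R (r 3)"
      unfolding R_def by (simp only: scale_left_distrib scale_right_distrib scale_scale ac_simps)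
    moreover have "R \<phi> = R (\<lambda>x. \<phi> a1 * r 0 x + \<phi> a2 * r 1 x + \<phi> a3 * r 2 x + \<phi> a4 * r 3 x)"
      unfolding R_def by (simp add: exp\<phi>[of "_ \<star> _"])
    ultimately show ?thesis by simp
  qed
  ultimately have "R \<phi> = 0" by simp
  then show ?thesis
    by (simp add: R_def b eval_nat_numeral lessThan_Suc ac_simps)
qed

text \<open>
  In a perfect algebra, the forms \<open>d\<phi>\<close> make up a totally isotropic subspace of the
  six-dimensional space of \<open>2\<close>-forms for the nondegenerate wedge pairing, so this subspace has
  dimension at most three. But \<open>\<phi> \<mapsto> d\<phi>\<close> is injective, so it has dimension four.
\<close>

lemma not_perfect_if_dim_4:
  assumes dim: "dim G = 4"
  shows "D \<noteq> G"
proof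
  assume perfect: "D = G"
  obtain B where B: "finite B" "card B = 4" "span B = G" "independent B"
    by (rule obtain_basis[OF subspace_carrier dim]) simp_all
  obtain as where as: "set as = B" "distinct as" using B(1) finite_distinct_list by blast
  then have "length as = 4" using B(2) distinct_card[of as] by simp
  then obtain a1 a2 a3 a4 where as_eq: "as = [a1, a2, a3, a4]"
    by (auto simp: eval_nat_numeral length_Suc_conv)
  have a [simp]: "a1 \<in> G" "a2 \<in> G" "a3 \<in> G" "a4 \<in> G"
    unfolding B(3)[symmetric] as(1)[symmetric] as_eq by (simp_all add: span_base)
  define b where "b = (!) [a1 \<star> a2, a3 \<star> a1, a1 \<star> a4, a2 \<star> a3, a2 \<star> a4, a3 \<star> a4]"
  have b_image: "b ` {..<6} = {a1 \<star> a2, a3 \<star> a1, a1 \<star> a4, a2 \<star> a3, a2 \<star> a4, a3 \<star> a4}"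
    by (auto simp: b_def eval_nat_numeral lessThan_Suc)
  have bG: "b q \<in> G" if "q < 6" for q
  proof -
    have "b q \<in> b ` {..<6}" using that by blast
    then show ?thesis unfolding b_image by auto
  qed
  have span_b: "span (b ` {..<6}) = G"
  proof
    show "span (b ` {..<6}) \<subseteq> G"
      by (rule span_minimal) (use bG subspace_carrier in auto)
    have anti: "a2 \<star> a1 = - (a1 \<star> a2)" "a1 \<star> a3 = - (a3 \<star> a1)" "a3 \<star> a2 = - (a2 \<star> a3)"
      "a4 \<star> a1 = - (a1 \<star> a4)" "a4 \<star> a2 = - (a2 \<star> a4)" "a4 \<star> a3 = - (a3 \<star> a4)"
      using a bracket_anti by blast+
    have "{x \<star> y |x y. x \<in> B \<and> y \<in> B} \<subseteq> span (b ` {..<6})"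
      unfolding b_image as(1)[symmetric] as_eq
      by (auto simp: bracket_self span_zero anti span_neg span_base)
    then show "G \<subseteq> span (b ` {..<6})"
      using span_minimal[OF _ subspace_span] D_eq_span[OF B(3)[symmetric]] perfect by blast
  qed
  \<comment> \<open>Four of the six brackets form a basis. A functional \<open>\<phi>\<close> that kills the partners of the other
    two turns the relation into a linear dependence of that basis, hence kills all brackets.\<close>
  obtain C where C: "C \<subseteq> b ` {..<6}" "independent C" "b ` {..<6} \<subseteq> span C"
    by (rule maximal_independent_subset)
  obtain S where S: "S \<subseteq> {..<6}" "inj_on b S" "C = b ` S"
    using C(1) by (meson subset_image_inj)
  have "G \<subseteq> span C" using span_minimal[OF C(3) subspace_span] span_b by blast
  moreover have "C \<subseteq> G" using C(1) span_b span_superset by blast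
  ultimately have "card C = 4" using C(2) dim basis_card_eq_dim[of C G] by simp
  then have "card S = 4" using S(3) card_image[OF S(2)] by simp
  have "finite S" using S(1) finite_subset by blast
  then have "card ({..<6} - S) = 2"
    using card_Diff_subset[of S "{..<6}"] S(1) \<open>card S = 4\<close> by simp
  then obtain p q where pq: "{..<6} - S = {p, q}" by (meson card_2_iff)
  then have "p < 6" "q < 6" by auto
  obtain \<phi> x where \<phi>: "\<And>x y. x \<in> G \<Longrightarrow> y \<in> G \<Longrightarrow> \<phi> (x + y) = \<phi> x + \<phi> y"
    "\<And>c x. x \<in> G \<Longrightarrow> \<phi> (c \<cdot> x) = c * \<phi> x" "\<phi> (b (5 - p)) = 0" "\<phi> (b (5 - q)) = 0"
    "x \<in> G" "\<phi> x \<noteq> 0"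
    by (rule obtain_functional_vanishing_at_two[of G "b (5 - p)" "b (5 - q)"])
      (use subspace_carrier dim bG in auto)
  have "(\<Sum>i\<in>S. \<phi> (b (5 - i)) \<cdot> b i) = (\<Sum>i<6. \<phi> (b (5 - i)) \<cdot> b i)"
    by (rule sum.mono_neutral_left) (use S(1) \<phi> pq in auto)
  also have "\<dots> = 0"
    by (rule bracket_relation[of a1 a2 a3 a4])
      (use B as as_eq perfect \<phi> b_def in auto)
  finally have "(\<Sum>v\<in>C. \<phi> (b (5 - inv_into S b v)) \<cdot> v) = 0"
    unfolding S(3) by (simp add: sum.reindex S(2) inv_into_f_f)
  then have coeff: "\<phi> (b (5 - inv_into S b v)) = 0" if "v \<in> C" for v
    using independentD[OF C(2), of C "\<lambda>v. \<phi> (b (5 - inv_into S b v))"] that S(3) \<open>finite S\<close> by auto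
  have "\<phi> (b (5 - i)) = 0" if "i \<in> S" for i
    using coeff[of "b i"] inv_into_f_f[OF S(2) that] S(3) that by simp
  moreover have "\<phi> (b (5 - i)) = 0" if "i \<in> {..<6} - S" for i
    using that \<phi> unfolding pq by auto
  ultimately have "\<phi> (b (5 - i)) = 0" if "i < 6" for i
    using that by blast
  then have zero: "\<phi> (b i) = 0" if "i < 6" for i
  proof -
    have "5 - i < 6" "5 - (5 - i) = i" using that by auto
    then show ?thesis using \<open>\<And>i. i < 6 \<Longrightarrow> \<phi> (b (5 - i)) = 0\<close> by metis
  qed
  have "x \<in> G \<and> \<phi> x = 0" if "x \<in> span (b ` {..<6})" for x
    using that
  proof (induction rule: span_induct_alt)
    case base
    then show ?case using \<phi>(2)[of 0 0] by simp
  next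
    case (step c x y)
    then show ?case using \<phi>(1,2) zero bG by auto
  qed
  then show False using \<phi>(5,6) span_b by blast
qed

end

section \<open>The derived algebra of a nonsolvable four-dimensional Lie algebra\<close>

lemma lie_solvable_if_derived:
  "lie_solvable (lie_derived L) \<Longrightarrow> lie_solvable L"
  unfolding lie_solvable_def by (metis comp_apply funpow_Suc_right)

context lie_algebra
begin

lemma D_subset_span2:
  assumes "G = span {a, b}"
  shows "D \<subseteq> span {a \<star> b}"
proof -
  have ab: "a \<in> G" "b \<in> G" using assms by (simp_all add: span_base)
  have "{x \<star> y |x y. x \<in> {a, b} \<and> y \<in> {a, b}} \<subseteq> span {a \<star> b}"
    using bracket_anti[OF ab] by (auto simp: bracket_self ab span_zero span_neg span_base)
  then show ?thesis
    using span_minimal[OF _ subspace_span] D_eq_span[OF assms] by blast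
qed

lemma D_eq_span3:
  assumes "G = span {a, b, c}"
  shows "D = span {a \<star> b, b \<star> c, c \<star> a}"
proof
  have abc: "a \<in> G" "b \<in> G" "c \<in> G" using assms by (simp_all add: span_base)
  then have anti: "b \<star> a = - (a \<star> b)" "c \<star> b = - (b \<star> c)" "a \<star> c = - (c \<star> a)"
    using bracket_anti by blast+
  have "{x \<star> y |x y. x \<in> {a, b, c} \<and> y \<in> {a, b, c}} \<subseteq> span {a \<star> b, b \<star> c, c \<star> a}"
    by (auto simp: bracket_self abc anti span_zero span_neg span_base)
  then show "D \<subseteq> span {a \<star> b, b \<star> c, c \<star> a}"
    using span_minimal[OF _ subspace_span] D_eq_span[OF assms] by blast
  show "span {a \<star> b, b \<star> c, c \<star> a} \<subseteq> D"
    by (rule span_minimal) (simp_all add: abc bracket_in_D subspace_D)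
qed

lemma solvable_if_dim_le_2:
  assumes "finite W" "G \<subseteq> span W" and "dim G \<le> 2"
  shows "lie_solvable L"
proof -
  obtain B where B: "B \<subseteq> G" "independent B" "G \<subseteq> span B" "card B = dim G"
    by (rule basis_exists)
  have "finite B" using independent_span_bound[OF assms(1) B(2)] B(1) assms(2) by blast
  have "\<exists>a b. G = span {a, b}"
  proof -
    have "span B = G" using B(1,3) subspace_carrier by (rule span_subspace)
    have "card B = 0 \<or> card B = 1 \<or> card B = 2" using B(4) assms(3) by linarith
    then consider "B = {}" | a where "B = {a}" | a b where "B = {a, b}"
      using \<open>finite B\<close> by (metis card_0_eq card_1_singletonE card_2_iff)
    then show ?thesis
    proof cases
      case 1
      then have "G = span {0, 0}" using \<open>span B = G\<close> by (simp only: span_insert_0)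
      then show ?thesis by blast
    next
      case (2 a)
      then have "G = span {a, a}" using \<open>span B = G\<close> by simp
      then show ?thesis by blast
    next
      case 3
      then show ?thesis using \<open>span B = G\<close> by blast
    qed
  qed
  then obtain a b where ab: "G = span {a, b}" by blast
  interpret D: lie_algebra "lie_derived L"
    rewrites "lie_scale (lie_derived L) = lie_scale L"
      and "lie_bracket (lie_derived L) = lie_bracket L"
    by (simp_all add: lie_algebra_derived)
  have "a \<star> b \<in> D"
    using ab by (intro bracket_in_D) (simp_all add: span_base)
  then have "D = span {a \<star> b, a \<star> b}"
    using D_subset_span2[OF ab] span_minimal[of "{a \<star> b}" D] subspace_D by auto
  then have "D.D \<subseteq> span {(a \<star> b) \<star> (a \<star> b)}"
    by (rule D.D_subset_span2)
  also have "\<dots> = {0}" using \<open>a \<star> b \<in> D\<close> by (simp add: bracket_self D_in_carrier)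
  finally have "D.D = {0}" using D.subspace_D subspace_0 by blast
  then have "lie_carrier ((lie_derived ^^ 2) L) = {0}" by (simp add: numeral_2_eq_2)
  then show ?thesis unfolding lie_solvable_def by blast
qed

text \<open>
  Every term of the derived series has dimension at least three, for otherwise the series reaches
  zero; and the first step has to lose a dimension because there is no perfect algebra of
  dimension four. So the series becomes stationary after one step.
\<close>

lemma derived_perfect_of_dim_3:
  assumes dim: "dim G = 4" and ns: "\<not> lie_solvable L"
  shows "dim D = 3" "lie_carrier (lie_derived (lie_derived L)) = D"
proof -
  interpret D: lie_algebra "lie_derived L"
    rewrites "lie_scale (lie_derived L) = lie_scale L"
      and "lie_bracket (lie_derived L) = lie_bracket L"
    by (simp_all add: lie_algebra_derived)
  interpret DD: lie_algebra "lie_derived (lie_derived L)"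
    rewrites "lie_scale (lie_derived (lie_derived L)) = lie_scale L"
      and "lie_bracket (lie_derived (lie_derived L)) = lie_bracket L"
    using D.lie_algebra_derived D.derived_simps by simp_all
  obtain W where W: "finite W" "span W = G"
    by (rule obtain_basis[OF subspace_carrier dim]) simp_all
  have D_ns: "\<not> lie_solvable (lie_derived L)"
    using ns lie_solvable_if_derived by blast
  have "D \<subseteq> span W" using W D_subset by blast
  then have "\<not> dim D \<le> 2"
    using D.solvable_if_dim_le_2[OF W(1)] D_ns by blast
  moreover have "dim D \<le> 4" using dim_mono_finite[OF D_subset] dim by simp
  moreover have "dim D \<noteq> 4"
    using subspace_eq_of_dim_le[OF subspace_D subspace_carrier D_subset] dim not_perfect_if_dim_4
    by auto
  ultimately show 3: "dim D = 3" by simp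
  have "D.D \<subseteq> span W" using W D_subset D.D_subset by blast
  then have "\<not> dim D.D \<le> 2"
    using DD.solvable_if_dim_le_2[OF W(1)] D_ns lie_solvable_if_derived by blast
  then show "D.D = D"
    using subspace_eq_of_dim_le[OF D.subspace_D subspace_D D.D_subset] 3 by auto
qed

end

section \<open>Perfect Lie algebras of dimension three\<close>

context lie_algebra
begin

text \<open>
  In dimension three, the exterior square is dual to the space itself, so the bracket is a bilinear form
  on the dual space. The Jacobi identity is a linear relation between the three basic brackets whose
  coefficients are the entries of the skew part of its matrix \<open>m\<close>; perfectness makes these
  brackets linearly independent.
\<close>

lemma structure_matrix_symmetric:
  assumes dim: "dim G = 3" and perfect: "D = G" and span: "G = span {a, b, c}"
    and m: "b \<star> c = m11 \<cdot> a + m12 \<cdot> b + m13 \<cdot> c" "c \<star> a = m21 \<cdot> a + m22 \<cdot> b + m23 \<cdot> c"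
      "a \<star> b = m31 \<cdot> a + m32 \<cdot> b + m33 \<cdot> c"
  shows "m21 = m12" "m31 = m13" "m32 = m23"
proof -
  have abc: "a \<in> G" "b \<in> G" "c \<in> G" using span by (simp_all add: span_base)
  have anti: "b \<star> a = - (a \<star> b)" "c \<star> b = - (b \<star> c)" "a \<star> c = - (c \<star> a)"
    using bracket_anti abc by blast+
  have "a \<star> (b \<star> c) = m12 \<cdot> (a \<star> b) - m13 \<cdot> (c \<star> a)"
    "b \<star> (c \<star> a) = m23 \<cdot> (b \<star> c) - m21 \<cdot> (a \<star> b)"
    "c \<star> (a \<star> b) = m31 \<cdot> (c \<star> a) - m32 \<cdot> (b \<star> c)"
    using abc by (simp_all only: m(1)[THEN arg_cong[of _ _ "(\<star>) a"]]
      m(2)[THEN arg_cong[of _ _ "(\<star>) b"]] m(3)[THEN arg_cong[of _ _ "(\<star>) c"]])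
      (simp_all add: bracket_linear bracket_self anti)
  from jacobi[OF abc, unfolded this]
  have "(m12 - m21) \<cdot> (a \<star> b) + (m23 - m32) \<cdot> (b \<star> c) + (m31 - m13) \<cdot> (c \<star> a) = 0"
    by (simp add: scale_left_diff_distrib algebra_simps)
  moreover have "3 \<le> dim (span {a \<star> b, b \<star> c, c \<star> a})"
    using D_eq_span3[OF span] perfect dim by simp
  ultimately show "m21 = m12" "m31 = m13" "m32 = m23"
    using independent3_of_dim by (metis eq_iff_diff_eq_0)+
qed

lemma span_generators:
  assumes span: "span {u, v, w} = G" and uv: "u \<star> v = \<alpha> \<cdot> u + \<beta> \<cdot> v + \<gamma> \<cdot> w" and "\<gamma> \<noteq> 0"
  shows "span {u, v, u \<star> v} = G"
proof
  have uvw: "u \<in> G" "v \<in> G" "w \<in> G" unfolding span[symmetric] by (simp_all add: span_base)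
  then show "span {u, v, u \<star> v} \<subseteq> G"
    by (intro span_minimal) (simp_all add: subspace_carrier)
  have "\<gamma> \<cdot> w = u \<star> v - \<alpha> \<cdot> u - \<beta> \<cdot> v" using uv by simp
  then have "inverse \<gamma> \<cdot> (\<gamma> \<cdot> w) = inverse \<gamma> \<cdot> (u \<star> v - \<alpha> \<cdot> u - \<beta> \<cdot> v)" by simp
  then have "w = inverse \<gamma> \<cdot> (u \<star> v - \<alpha> \<cdot> u - \<beta> \<cdot> v)" using \<open>\<gamma> \<noteq> 0\<close> by simp
  also have "\<dots> \<in> span {u, v, u \<star> v}"
    by (intro span_scale span_diff) (simp_all add: span_base)
  finally show "G \<subseteq> span {u, v, u \<star> v}"
    unfolding span[symmetric] by (intro span_minimal) (simp_all add: span_base)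
qed

text \<open>
  A suitable pair exists unless all planes are subalgebras, that is, unless the form given by the
  structure matrix is alternating. A nondegenerate form on a space of odd dimension is not
  alternating. Its matrix can still have a zero diagonal, and then a change of basis is needed.
\<close>

lemma obtain_generators:
  assumes dim: "dim G = 3" and perfect: "D = G"
  obtains u v where "span {u, v, u \<star> v} = G"
proof -
  obtain a b c where span: "span {a, b, c} = G"
    using obtain_basis3[OF subspace_carrier dim] by blast
  have abc: "a \<in> G" "b \<in> G" "c \<in> G" unfolding span[symmetric] by (simp_all add: span_base)
  have "b \<star> c \<in> span {a, b, c}" "c \<star> a \<in> span {a, b, c}" "a \<star> b \<in> span {a, b, c}"
    using abc span by simp_all
  then obtain p x y x' q z y' z' r where m:
    "b \<star> c = p \<cdot> a + x \<cdot> b + y \<cdot> c" "c \<star> a = x' \<cdot> a + q \<cdot> b + z \<cdot> c"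
    "a \<star> b = y' \<cdot> a + z' \<cdot> b + r \<cdot> c"
    unfolding in_span3 by blast
  have sym [simp]: "x' = x" "y' = y" "z' = z"
    using structure_matrix_symmetric[OF dim perfect span[symmetric] m] by simp_all
  consider "r \<noteq> 0" | "p \<noteq> 0" | "q \<noteq> 0" | "p = 0" "q = 0" "r = 0" by blast
  then show ?thesis
  proof cases
    case 1
    then show ?thesis using span_generators[OF span m(3)] that by blast
  next
    case 2
    have "span {b, c, b \<star> c} = G"
      by (rule span_generators[of b c a x y p]) (use 2 span m(1) in \<open>auto simp: insert_commute ac_simps\<close>)
    then show ?thesis by (rule that)
  next
    case 3
    have "span {c, a, c \<star> a} = G"
      by (rule span_generators[of c a b z x q]) (use 3 span m(2) in \<open>auto simp: insert_commute ac_simps\<close>)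
    then show ?thesis by (rule that)
  next
    case 4
    \<comment> \<open>The structure matrix has zero diagonal; as it is invertible, its determinant \<open>2xyz\<close> does not vanish.\<close>
    have 3: "3 \<le> dim (span {a \<star> b, b \<star> c, c \<star> a})"
      using D_eq_span3[OF span[symmetric]] perfect dim by simp
    have "2 * z \<noteq> 0"
    proof
      assume "2 * z = 0"
      then have "(2 * z) * y = 0" by (rule ssubst) (rule mult_zero_left)
      then have "z * y + z * y = 0" by (simp only: mult_2 distrib_right)
      moreover have "(- x) \<cdot> (a \<star> b) + z \<cdot> (b \<star> c) + y \<cdot> (c \<star> a) = (z * y) \<cdot> c + (z * y) \<cdot> c"
        unfolding m sym 4 by (simp add: scale_right_distrib ac_simps)
      ultimately have "(- x) \<cdot> (a \<star> b) + z \<cdot> (b \<star> c) + y \<cdot> (c \<star> a) = 0"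
        by (simp only: scale_zero_left flip: scale_left_distrib)
      from independent3_of_dim[OF 3 this] have "0 \<cdot> (a \<star> b) + 1 \<cdot> (b \<star> c) + 0 \<cdot> (c \<star> a) = 0"
        using m(1) 4 by simp
      from independent3_of_dim(2)[OF 3 this] show False by simp
    qed
    have double: "(2 * z) \<cdot> c = z \<cdot> c + z \<cdot> c" by (simp only: mult_2 scale_left_distrib)
    have "a \<star> (b + c) = a \<star> b - c \<star> a"
      using abc bracket_anti[of c a] by (simp add: bracket_linear)
    also have "\<dots> = (y - x) \<cdot> a + z \<cdot> (b + c) + (- (2 * z)) \<cdot> c"
      unfolding m sym 4
      by (simp add: scale_right_distrib double scale_left_diff_distrib)
    finally have bra: "a \<star> (b + c) = (y - x) \<cdot> a + z \<cdot> (b + c) + (- (2 * z)) \<cdot> c" .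
    have "span {a, b + c, c} = G"
    proof
      show "span {a, b + c, c} \<subseteq> G"
        by (intro span_minimal) (simp_all add: abc subspace_carrier)
      have "b = (b + c) - c" by simp
      also have "\<dots> \<in> span {a, b + c, c}" by (intro span_diff) (simp_all add: span_base)
      finally show "G \<subseteq> span {a, b + c, c}"
        unfolding span[symmetric] by (intro span_minimal) (simp_all add: span_base)
    qed
    from span_generators[OF this bra] \<open>2 * z \<noteq> 0\<close> show ?thesis by (intro that) simp
  qed
qed

text \<open>
  The symmetric matrix attached to the basis \<open>u, v, w\<close> has the last row \<open>(0, 0, 1)\<close>, and the
  remaining \<open>2 \<times> 2\<close> block has the entries \<open>a, b, b, c\<close>. It is invertible because the
  brackets span.
\<close>

lemma obtain_normal_form:
  assumes dim: "dim G = 3" and perfect: "D = G"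
  obtains u v w a b c where "span {u, v, w} = G" "u \<star> v = w"
    "v \<star> w = a \<cdot> u + b \<cdot> v" "w \<star> u = b \<cdot> u + c \<cdot> v" "b * b - a * c \<noteq> 0"
proof -
  obtain u v where span: "span {u, v, u \<star> v} = G"
    using obtain_generators[OF dim perfect] by blast
  define w where "w = u \<star> v"
  note span = span[folded w_def]
  have uvw: "u \<in> G" "v \<in> G" "w \<in> G" unfolding span[symmetric] by (simp_all add: span_base)
  have "v \<star> w \<in> span {u, v, w}" "w \<star> u \<in> span {u, v, w}"
    using uvw span by simp_all
  then obtain a b m b' c n where m: "v \<star> w = a \<cdot> u + b \<cdot> v + m \<cdot> w" "w \<star> u = b' \<cdot> u + c \<cdot> v + n \<cdot> w"
    unfolding in_span3 by blast
  have "u \<star> v = 0 \<cdot> u + 0 \<cdot> v + 1 \<cdot> w" using w_def by simp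
  from structure_matrix_symmetric[OF dim perfect span[symmetric] m this]
  have bra: "v \<star> w = a \<cdot> u + b \<cdot> v" "w \<star> u = b \<cdot> u + c \<cdot> v" using m by auto
  have 3: "3 \<le> dim (span {u \<star> v, v \<star> w, w \<star> u})"
    using D_eq_span3[OF span[symmetric]] perfect dim by simp
  have "b * b - a * c \<noteq> 0"
  proof
    assume eq: "b * b - a * c = 0"
    have "0 \<cdot> (u \<star> v) + b \<cdot> (v \<star> w) + (- a) \<cdot> (w \<star> u) = (b * b - a * c) \<cdot> v"
      unfolding bra by (simp add: scale_right_distrib scale_left_diff_distrib mult.commute)
    also have "\<dots> = 0" using eq by simp
    finally have "0 \<cdot> (u \<star> v) + b \<cdot> (v \<star> w) + (- a) \<cdot> (w \<star> u) = 0" .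
    from independent3_of_dim[OF 3 this] have "a = 0" "b = 0" by simp_all
    then have "0 \<cdot> (u \<star> v) + 1 \<cdot> (v \<star> w) + 0 \<cdot> (w \<star> u) = 0" using bra by simp
    from independent3_of_dim(2)[OF 3 this] show False by simp
  qed
  with span bra w_def that show ?thesis by blast
qed

end

section \<open>Binary quadratic forms over finite fields\<close>

text \<open>
  More than half of the elements of the field are squares, so the affine images
  \<open>p S\<close> and \<open>1 - q S\<close> of the set \<open>S\<close> of squares intersect.
\<close>

lemma two_squares_represent_one:
  fixes p q :: "'k::{field,finite}"
  assumes 2: "(2 :: 'k) \<noteq> 0" and "p \<noteq> 0" "q \<noteq> 0"
  obtains x y where "p * x\<^sup>2 + q * y\<^sup>2 = 1"
proof -
  let ?n = "card (UNIV :: 'k set)"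
  define Sq :: "'k set" where "Sq = range (\<lambda>x. x\<^sup>2)"
  have fiber: "card {x :: 'k. x\<^sup>2 = s} \<le> 2" if s: "s \<in> Sq" for s
  proof -
    obtain y where "s = y\<^sup>2" using s by (auto simp: Sq_def)
    then have "{x. x\<^sup>2 = s} = {y, - y}" by (auto simp: power2_eq_iff)
    then show ?thesis by (simp add: card_insert_if)
  qed
  \<comment> \<open>The fibre of squaring over zero has only one element; this makes the bound strict.\<close>
  have "?n = card (insert 0 (\<Union>s\<in>Sq - {0}. {x :: 'k. x\<^sup>2 = s}))"
    by (rule arg_cong[of _ _ card]) (auto simp: Sq_def)
  also have "\<dots> \<le> Suc (card (\<Union>s\<in>Sq - {0}. {x :: 'k. x\<^sup>2 = s}))"
    by (rule card_insert_le_m1) simp_all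
  also have "card (\<Union>s\<in>Sq - {0}. {x :: 'k. x\<^sup>2 = s}) \<le> (\<Sum>s\<in>Sq - {0}. card {x :: 'k. x\<^sup>2 = s})"
    by (rule card_UN_le) simp
  also have "\<dots> \<le> (\<Sum>s\<in>Sq - {0}. 2)"
    by (rule sum_mono) (use fiber in blast)
  also have "\<dots> = 2 * (card Sq - 1)"
    by (simp add: Sq_def card_Diff_singleton image_iff)
  finally have "?n \<le> Suc (2 * (card Sq - 1))" by simp
  moreover have "card Sq > 0" by (simp add: Sq_def card_gt_0_iff)
  ultimately have big: "?n < 2 * card Sq" by simp
  have "card ((\<lambda>s. p * s) ` Sq) = card Sq" "card ((\<lambda>s. 1 - q * s) ` Sq) = card Sq"
    using assms by (auto intro!: card_image inj_onI)
  moreover have "card ((\<lambda>s. p * s) ` Sq \<union> (\<lambda>s. 1 - q * s) ` Sq) \<le> ?n"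
    by (rule card_mono) simp_all
  ultimately have "(\<lambda>s. p * s) ` Sq \<inter> (\<lambda>s. 1 - q * s) ` Sq \<noteq> {}"
    using big card_Un_disjoint[of "(\<lambda>s. p * s) ` Sq" "(\<lambda>s. 1 - q * s) ` Sq"] by auto
  then obtain x y where "p * x\<^sup>2 = 1 - q * y\<^sup>2" by (auto simp: Sq_def)
  then show ?thesis using that by (simp add: algebra_simps)
qed

text \<open>
  For \<open>c \<noteq> 0\<close>, completing the square diagonalizes the form. For \<open>c = 0\<close> it is linear in
  \<open>x\<close> once \<open>y\<close> is fixed.
\<close>

lemma binary_form_represents_one:
  fixes a b c :: "'k::{field,finite}"
  assumes 2: "(2 :: 'k) \<noteq> 0" and "b * b - a * c \<noteq> 0"
  obtains x y where "2 * b * x * y - c * x * x - a * y * y = 1"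
proof (cases "c = 0")
  case True
  then have "b \<noteq> 0" using assms by auto
  then show ?thesis using that[of "(1 + a) / (2 * b)" 1] True 2 by (simp add: field_simps)
next
  case False
  then obtain X y where 1: "- c * X\<^sup>2 + (b * b - a * c) / c * y\<^sup>2 = 1"
    using two_squares_represent_one[OF 2, of "- c" "(b * b - a * c) / c"] assms(2) by auto
  define x where "x = X + b * y / c"
  have cx: "c * x = c * X + b * y" using False by (simp add: x_def field_simps)
  have "c * (- c * X\<^sup>2 + (b * b - a * c) / c * y\<^sup>2) = - (c * X)\<^sup>2 + (b * b - a * c) * y\<^sup>2"
    using False by (simp add: field_simps power2_eq_square)
  then have "c = - (c * X)\<^sup>2 + (b * b - a * c) * y\<^sup>2" using 1 by simp
  also have "c * X = c * x - b * y" using cx by simp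
  also have "- (c * x - b * y)\<^sup>2 + (b * b - a * c) * y\<^sup>2 = c * (2 * b * x * y - c * x * x - a * y * y)"
    by (simp add: power2_eq_square algebra_simps)
  finally have "2 * b * x * y - c * x * x - a * y * y = 1" using False
    by (metis mult_cancel_left mult.right_neutral)
  then show ?thesis by (rule that)
qed

section \<open>Standard bases in dimension three\<close>

context lie_algebra
begin

text \<open>
  In characteristic two, the quadratic form \<open>\<phi> \<mapsto> a \<phi>(u)\<^sup>2 + c \<phi>(v)\<^sup>2 + \<phi>(w)\<^sup>2\<close> of the structure
  matrix is additive. With \<open>a = s\<^sup>2\<close> and \<open>c = t\<^sup>2\<close> it equals \<open>\<phi>(h)\<^sup>2\<close> for
  \<open>h = w + s u + t v\<close>, which singles out this vector. It acts on the quotient by its own line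
  as the scalar \<open>\<epsilon> = b + s t\<close>, and adding multiples of \<open>h\<close> to \<open>u\<close> and \<open>v\<close> makes them
  eigenvectors.
\<close>

lemma obtain_triple_char_2:
  assumes dim: "dim G = 3" and perfect: "D = G"
    and two: "(2 :: 'k) = 0" and sqrt: "\<And>x :: 'k. \<exists>y. x = y * y"
  obtains e h f where "span {e, h, f} = G" "h \<star> e = e" "h \<star> f = f" "e \<star> f = h"
proof -
  obtain u v w a b c where span: "span {u, v, w} = G" and "u \<star> v = w"
    "v \<star> w = a \<cdot> u + b \<cdot> v" "w \<star> u = b \<cdot> u + c \<cdot> v" and det: "b * b - a * c \<noteq> 0"
    by (rule obtain_normal_form[OF dim perfect])
  obtain s t where s: "a = s * s" and t: "c = t * t" using sqrt by metis
  note [simp] = char_2_simps[OF two]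
  have uvw [simp]: "u \<in> G" "v \<in> G" "w \<in> G"
    unfolding span[symmetric] by (simp_all add: span_base)
  have bra [simp]: "u \<star> v = w" "v \<star> w = (s * s) \<cdot> u + b \<cdot> v" "w \<star> u = b \<cdot> u + (t * t) \<cdot> v"
    "v \<star> u = w" "w \<star> v = (s * s) \<cdot> u + b \<cdot> v" "u \<star> w = b \<cdot> u + (t * t) \<cdot> v"
    using \<open>u \<star> v = w\<close> \<open>v \<star> w = _\<close> \<open>w \<star> u = _\<close> s t bracket_anti[of u v] bracket_anti[of v w]
      bracket_anti[of w u] by simp_all
  define h where "h = w + s \<cdot> u + t \<cdot> v"
  define \<epsilon> where "\<epsilon> = b + s * t"
  have "\<epsilon> * \<epsilon> = b * b - a * c"
    by (simp add: \<epsilon>_def s t algebra_simps)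
  then have [simp]: "\<epsilon> \<noteq> 0" using det by auto
  have hG [simp]: "h \<in> G" by (simp add: h_def)
  have hu: "h \<star> u = \<epsilon> \<cdot> u + t \<cdot> h" and hv: "h \<star> v = \<epsilon> \<cdot> v + s \<cdot> h"
    by (simp_all add: h_def \<epsilon>_def bracket_linear bracket_self scale_left_distrib
        scale_right_distrib ac_simps)
  then have uh: "u \<star> h = \<epsilon> \<cdot> u + t \<cdot> h"
    using bracket_anti[of h u] by simp
  define u' where "u' = u + (t / \<epsilon>) \<cdot> h"
  define v' where "v' = v + (s / \<epsilon>) \<cdot> h"
  have [simp]: "u' \<in> G" "v' \<in> G" by (simp_all add: u'_def v'_def)
  have hu': "h \<star> u' = \<epsilon> \<cdot> u'" and hv': "h \<star> v' = \<epsilon> \<cdot> v'"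
    by (simp_all add: u'_def v'_def bracket_linear bracket_self hu hv scale_right_distrib)
  have uv': "u' \<star> v' = h"
    by (simp add: u'_def v'_def bracket_linear bracket_self uh hv scale_right_distrib ac_simps)
      (simp add: h_def scale_right_distrib ac_simps)
  let ?V = "span {inverse \<epsilon> \<cdot> u', inverse \<epsilon> \<cdot> h, v'}"
  have "?V = G"
  proof
    show "?V \<subseteq> G" by (intro span_minimal) (simp_all add: subspace_carrier)
    have "u' = \<epsilon> \<cdot> (inverse \<epsilon> \<cdot> u')" "h = \<epsilon> \<cdot> (inverse \<epsilon> \<cdot> h)" by simp_all
    then have V: "u' \<in> ?V" "h \<in> ?V" "v' \<in> ?V"
      by (metis insertI1 insertI2 span_base span_scale)+
    have "u = u' - (t / \<epsilon>) \<cdot> h" "v = v' - (s / \<epsilon>) \<cdot> h"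
      by (simp_all only: u'_def v'_def add_diff_cancel_right')
    then have uv: "u \<in> ?V" "v \<in> ?V" using V by (metis span_diff span_scale)+
    have "w = h - t \<cdot> v - s \<cdot> u" by (simp only: h_def add_diff_cancel_right')
    then have "w \<in> ?V" using V uv by (metis span_diff span_scale)
    then show "G \<subseteq> ?V" unfolding span[symmetric] using uv by (intro span_minimal) simp_all
  qed
  moreover have "(inverse \<epsilon> \<cdot> h) \<star> (inverse \<epsilon> \<cdot> u') = inverse \<epsilon> \<cdot> u'"
    "(inverse \<epsilon> \<cdot> h) \<star> v' = v'" "(inverse \<epsilon> \<cdot> u') \<star> v' = inverse \<epsilon> \<cdot> h"
    by (simp_all add: bracket_linear hu' hv' uv')
  ultimately show ?thesis by (rule that)
qed

text \<open>
  The trace form restricted to the plane of \<open>u\<close> and \<open>v\<close> is, up to the factor \<open>2\<close>, the binary form in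
  the assumption. Where it takes the value one, \<open>x = \<alpha> u + \<beta> v\<close> satisfies \<open>(ad x)\<^sup>2 = 1\<close> on the plane
  spanned by \<open>w\<close> and \<open>y = [x, w]\<close>. So \<open>ad x\<close> has the eigenvectors \<open>y + w\<close> and
  \<open>y - w\<close> for the eigenvalues \<open>1\<close> and \<open>- 1\<close>, and \<open>h = 2 x\<close> is split.
\<close>

lemma obtain_sl2_triple:
  assumes dim: "dim G = 3" and perfect: "D = G"
    and two: "(2 :: 'k) \<noteq> 0" 
    and binary: "\<And>a b c :: 'k. b * b - a * c \<noteq> 0 \<Longrightarrow>
      \<exists>x y. 2 * b * x * y - c * x * x - a * y * y = 1"
  obtains e h f where "span {e, h, f} = G" "h \<star> e = 2 \<cdot> e" "h \<star> f = (- 2) \<cdot> f" "e \<star> f = h"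
proof -
  obtain u v w a b c where span: "span {u, v, w} = G" and "u \<star> v = w"
    "v \<star> w = a \<cdot> u + b \<cdot> v" "w \<star> u = b \<cdot> u + c \<cdot> v" and det: "b * b - a * c \<noteq> 0"
    by (rule obtain_normal_form[OF dim perfect])
  have uvw [simp]: "u \<in> G" "v \<in> G" "w \<in> G"
    unfolding span[symmetric] by (simp_all add: span_base)
  have bra [simp]: "u \<star> v = w" "v \<star> w = a \<cdot> u + b \<cdot> v" "w \<star> u = b \<cdot> u + c \<cdot> v"
    "v \<star> u = - w" "w \<star> v = - (a \<cdot> u + b \<cdot> v)" "u \<star> w = - (b \<cdot> u + c \<cdot> v)"
    using \<open>u \<star> v = w\<close> \<open>v \<star> w = _\<close> \<open>w \<star> u = _\<close> bracket_anti[of u v] bracket_anti[of v w]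
      bracket_anti[of w u] by simp_all
  define \<delta> where "\<delta> = b * b - a * c"
  have [simp]: "\<delta> \<noteq> 0" using det by (simp add: \<delta>_def)
  obtain \<alpha> \<beta> where q: "2 * b * \<alpha> * \<beta> - c * \<alpha> * \<alpha> - a * \<beta> * \<beta> = 1"
    using binary[OF det] by blast
  define \<mu> where "\<mu> = \<beta> * a - \<alpha> * b"
  define \<nu> where "\<nu> = \<beta> * b - \<alpha> * c"
  have q': "\<alpha> * \<nu> - \<beta> * \<mu> = 1" using q by (simp add: \<mu>_def \<nu>_def algebra_simps)
  define x where "x = \<alpha> \<cdot> u + \<beta> \<cdot> v"
  define y where "y = \<mu> \<cdot> u + \<nu> \<cdot> v"
  have [simp]: "x \<in> G" "y \<in> G" by (simp_all add: x_def y_def)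
  have xw: "x \<star> w = y"
    by (simp add: x_def y_def \<mu>_def \<nu>_def bracket_linear scale_right_distrib
        scale_left_diff_distrib algebra_simps)
  have xy: "x \<star> y = w"
  proof -
    have "x \<star> y = (\<alpha> * \<nu> - \<beta> * \<mu>) \<cdot> w"
      by (simp add: x_def y_def bracket_linear bracket_self scale_left_diff_distrib algebra_simps)
    then show ?thesis using q' by simp
  qed
  have wy: "w \<star> y = (- \<delta>) \<cdot> x"
  proof -
    have "w \<star> y = (\<mu> * b - \<nu> * a) \<cdot> u + (\<mu> * c - \<nu> * b) \<cdot> v"
      by (simp add: y_def bracket_linear scale_right_distrib scale_left_diff_distrib algebra_simps)
    moreover have "\<mu> * b - \<nu> * a = - \<delta> * \<alpha>" "\<mu> * c - \<nu> * b = - \<delta> * \<beta>"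
      by (simp_all add: \<mu>_def \<nu>_def \<delta>_def algebra_simps)
    ultimately show ?thesis by (simp add: x_def scale_right_distrib)
  qed
  then have yw: "y \<star> w = \<delta> \<cdot> x" using bracket_anti[of w y] by simp
  have double: "z + z = 2 \<cdot> z" for z
    by (simp only: scale_left_distrib scale_one flip: one_add_one)
  define h where "h = 2 \<cdot> x"
  define e where "e = (- inverse \<delta>) \<cdot> (y + w)"
  define f where "f = y - w"
  have [simp]: "h \<in> G" "e \<in> G" "f \<in> G" by (simp_all add: h_def e_def f_def)
  have he: "h \<star> e = 2 \<cdot> e"
    by (simp add: h_def e_def bracket_linear bracket_minus bracket_diff xy xw scale_right_distrib
        scale_right_diff_distrib ac_simps)
  have hf: "h \<star> f = (- 2) \<cdot> f"
    by (simp add: h_def f_def bracket_linear bracket_diff xy xw scale_right_diff_distrib)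
  have ef: "e \<star> f = h"
  proof -
    have "(y + w) \<star> (y - w) = w \<star> y - y \<star> w"
      by (simp add: bracket_linear bracket_diff bracket_self)
    then have "e \<star> f = (- inverse \<delta>) \<cdot> (w \<star> y - y \<star> w)"
      by (simp only: e_def f_def bracket_scale_left carrier_closed uvw \<open>y \<in> G\<close>)
    also have "\<dots> = x + x"
      by (simp add: wy yw scale_right_diff_distrib)
    finally show ?thesis by (simp only: h_def double)
  qed
  have "span {e, h, f} = G"
  proof
    let ?V = "span {e, h, f}"
    show "?V \<subseteq> G" by (intro span_minimal) (simp_all add: subspace_carrier)
    have half: "inverse 2 \<cdot> (z + z) = z" for z using two by (simp add: double)
    have V: "e \<in> ?V" "h \<in> ?V" "f \<in> ?V" by (simp_all add: span_base)
    have x: "x \<in> ?V"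
    proof -
      have "x = inverse 2 \<cdot> h" using two by (simp add: h_def)
      then show ?thesis using V by (simp add: span_scale)
    qed
    have yw: "y + w \<in> ?V"
    proof -
      have "y + w = (- \<delta>) \<cdot> e" by (simp add: e_def)
      then show ?thesis using V span_scale by metis
    qed
    have y: "y \<in> ?V"
    proof -
      have "y = inverse 2 \<cdot> ((y + w) + f)" using half[of y] by (simp add: f_def)
      then show ?thesis using V yw by (metis span_add span_scale)
    qed
    have w: "w \<in> ?V" using span_diff[OF yw y] by simp
    have "\<nu> \<cdot> x - \<beta> \<cdot> y = (\<alpha> * \<nu> - \<beta> * \<mu>) \<cdot> u" "\<alpha> \<cdot> y - \<mu> \<cdot> x = (\<alpha> * \<nu> - \<beta> * \<mu>) \<cdot> v"
      by (simp_all add: x_def y_def scale_right_distrib scale_left_diff_distrib algebra_simps)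
    then have "u = \<nu> \<cdot> x - \<beta> \<cdot> y" "v = \<alpha> \<cdot> y - \<mu> \<cdot> x"
      using q' by simp_all
    then have "u \<in> ?V" "v \<in> ?V" using x y by (metis span_diff span_scale)+
    with w show "G \<subseteq> ?V" unfolding span[symmetric] by (intro span_minimal) simp_all
  qed
  then show ?thesis using he hf ef by (rule that)
qed

end

section \<open>The action on the derived algebra\<close>

context lie_algebra
begin

lemma obtain_complement:
  assumes dim: "dim G = 4" "dim D = 3" and D: "D = span {e, h, f}"
  obtains t where "span {e, h, f, t} = G"
proof -
  have "D \<noteq> G" using dim by auto
  then obtain t where t: "t \<in> G" "t \<notin> D" using D_subset by blast
  let ?V = "span {e, h, f, t}"
  have VG: "?V \<subseteq> G"
    using D_subset t D by (intro span_minimal) (auto simp: subspace_carrier span_base subset_iff)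
  have DV: "D \<subseteq> ?V" unfolding D by (rule span_mono) blast
  have "t \<in> ?V" by (simp add: span_base)
  have "0 < dim ?V"
  proof (rule ccontr)
    assume 0: "\<not> 0 < dim ?V"
    obtain B where B: "B \<subseteq> ?V" "independent B" "?V \<subseteq> span B" "card B = dim ?V"
      by (rule basis_exists)
    have "finite B" using independent_span_bound[of "{e, h, f, t}" B] B by simp
    then have "B = {}" using B(4) 0 by simp
    then have "t = 0" using \<open>t \<in> ?V\<close> B(3) by auto
    then show False using t(2) subspace_0[OF subspace_D] by simp
  qed
  then have "\<not> dim ?V \<le> dim D"
    using subspace_eq_of_dim_le[OF subspace_D subspace_span DV] \<open>t \<in> ?V\<close> t(2) by blast
  then have "?V = G"
    using subspace_eq_of_dim_le[OF subspace_span subspace_carrier VG] dim by simp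
  then show ?thesis by (rule that)
qed

text \<open>
  The derivation \<open>ad t\<close> of the derived algebra is made inner as far as possible. Comparing
  coefficients in the Leibniz rule for the three brackets leaves only the inner derivations and
  the maps \<open>e \<mapsto> a f\<close>, \<open>f \<mapsto> c e\<close> with \<open>2 a = 2 c = 0\<close>; subtracting an inner derivation gives
  \<open>z\<close>. The parameter \<open>\<tau>\<close> is \<open>2\<close> in odd characteristic, where \<open>z\<close> is then central, and \<open>1 = - 1\<close> in
  characteristic two, where outer derivations remain.
\<close>

lemma obtain_reduced_derivation:
  assumes dim: "dim D = 3" and D: "D = span {e, h, f}" and G: "span {e, h, f, t} = G"
    and "\<tau> \<noteq> 0" and triple: "h \<star> e = \<tau> \<cdot> e" "h \<star> f = (- \<tau>) \<cdot> f" "e \<star> f = h"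
  obtains z a c where "span {e, h, f, z} = G" "z \<star> h = 0" "z \<star> e = a \<cdot> f" "z \<star> f = c \<cdot> e"
    "2 * a = 0" "2 * c = 0"
proof -
  have [simp]: "e \<in> G" "h \<in> G" "f \<in> G" "t \<in> G"
    unfolding G[symmetric] by (simp_all add: span_base)
  have anti: "e \<star> h = - (\<tau> \<cdot> e)" "f \<star> h = \<tau> \<cdot> f" "f \<star> e = - h"
    using bracket_anti[of h e] bracket_anti[of h f] bracket_anti[of e f] triple by simp_all
  have "t \<star> e \<in> span {e, h, f}" "t \<star> h \<in> span {e, h, f}" "t \<star> f \<in> span {e, h, f}"
    using bracket_in_D by (simp_all flip: D)
  then obtain a1 a2 a3 b1 b2 b3 c1 c2 c3 where
    te: "t \<star> e = a1 \<cdot> e + a2 \<cdot> h + a3 \<cdot> f" and th: "t \<star> h = b1 \<cdot> e + b2 \<cdot> h + b3 \<cdot> f"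
    and tf: "t \<star> f = c1 \<cdot> e + c2 \<cdot> h + c3 \<cdot> f"
    unfolding in_span3 by blast
  have leibniz: "t \<star> (x \<star> y) = (t \<star> x) \<star> y + x \<star> (t \<star> y)" if "x \<in> G" "y \<in> G" for x y
    using jacobi_left[of t x y] that by simp
  have 3: "3 \<le> dim (span {e, h, f})" using dim D by simp
  have "(\<tau> * a1) \<cdot> e + (\<tau> * a2) \<cdot> h + (\<tau> * a3) \<cdot> f =
      (\<tau> * b2 + \<tau> * a1) \<cdot> e + (- b3) \<cdot> h + (- (\<tau> * a3)) \<cdot> f"
    using leibniz[of h e]
    by (simp add: te th triple anti bracket_linear bracket_self scale_right_distrib
        scale_left_distrib ac_simps)
  note 1 = coeffs_eq3_of_dim[OF 3 this]
  have "(- (\<tau> * c1)) \<cdot> e + (- (\<tau> * c2)) \<cdot> h + (- (\<tau> * c3)) \<cdot> f =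
      (\<tau> * c1) \<cdot> e + b1 \<cdot> h + (- (\<tau> * b2) + - (\<tau> * c3)) \<cdot> f"
    using leibniz[of h f]
    by (simp add: tf th triple anti bracket_linear bracket_minus bracket_self scale_right_distrib
        scale_left_distrib scale_left_diff_distrib ac_simps del: add_uminus_conv_diff)
  note 2 = coeffs_eq3_of_dim[OF 3 this]
  have "b1 \<cdot> e + b2 \<cdot> h + b3 \<cdot> f = (- (\<tau> * c2)) \<cdot> e + (a1 + c3) \<cdot> h + (- (\<tau> * a2)) \<cdot> f"
    using leibniz[of e f]
    by (simp add: te tf th triple anti bracket_linear bracket_self scale_right_distrib
        scale_left_distrib ac_simps)
  note 3 = coeffs_eq3_of_dim[OF 3 this]
  have b: "b1 = - (\<tau> * c2)" "b2 = 0" "b3 = - (\<tau> * a2)" "c3 = - a1"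
    using 1 3 \<open>\<tau> \<noteq> 0\<close> by (auto simp: eq_neg_iff_add_eq_0 add.commute)
  define z where "z = t - c2 \<cdot> e - (a1 / \<tau>) \<cdot> h + a2 \<cdot> f"
  have "z \<star> h = 0" "z \<star> e = a3 \<cdot> f" "z \<star> f = c1 \<cdot> e"
    using \<open>\<tau> \<noteq> 0\<close>
    by (simp_all add: z_def bracket_linear bracket_diff bracket_self triple anti te th tf b mult.commute)
  moreover have "2 * a3 = 0" "2 * c1 = 0"
    using 1(3) 2(1) \<open>\<tau> \<noteq> 0\<close> by (simp_all add: eq_neg_iff_add_eq_0 flip: distrib_left mult_2)
  moreover have "span {e, h, f, z} = G"
  proof
    let ?V = "span {e, h, f, z}"
    show "?V \<subseteq> G" by (intro span_minimal) (simp_all add: subspace_carrier z_def)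
    have V: "e \<in> ?V" "h \<in> ?V" "f \<in> ?V" "z \<in> ?V" by (simp_all add: span_base)
    have "t = z + c2 \<cdot> e + (a1 / \<tau>) \<cdot> h - a2 \<cdot> f" by (simp add: z_def)
    also have "\<dots> \<in> ?V" using V by (intro span_add span_diff span_scale)
    finally show "G \<subseteq> ?V" unfolding G[symmetric] using V by (intro span_minimal) simp_all
  qed
  ultimately show ?thesis using that by blast
qed

text \<open>
  For \<open>a = r\<^sup>2\<close>, \<open>c = s\<^sup>2\<close> the derivation \<open>ad z\<close> agrees with \<open>(ad f')\<^sup>2\<close>, where
  \<open>f' = s e + r f\<close>, up to the inner derivation of \<open>r s h\<close>. Any \<open>e'\<close> in the plane of \<open>e\<close> and
  \<open>f\<close> with \<open>[e', f'] = h\<close> completes \<open>f'\<close> to a triple of the same type, in which the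
  square \<open>(ad f')\<^sup>2\<close> maps \<open>e'\<close> to \<open>f'\<close> and kills the other two vectors.
\<close>

lemma obtain_outer_square_derivation:
  assumes two: "(2 :: 'k) = 0" and sqrt: "\<And>x :: 'k. \<exists>y. x = y * y"
    and G: "span {e, h, f, z} = G"
    and triple: "h \<star> e = e" "h \<star> f = f" "e \<star> f = h"
    and z: "z \<star> h = 0" "z \<star> e = a \<cdot> f" "z \<star> f = c \<cdot> e" and ac: "a \<noteq> 0 \<or> c \<noteq> 0"
  obtains e' f' t where "span {e', h, f', t} = G" "h \<star> e' = e'" "h \<star> f' = f'" "e' \<star> f' = h"
    "t \<star> h = 0" "t \<star> e' = f'" "t \<star> f' = 0"
proof -
  note [simp] = char_2_simps[OF two]
  have [simp]: "e \<in> G" "h \<in> G" "f \<in> G" "z \<in> G"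
    unfolding G[symmetric] by (simp_all add: span_base)
  have fe: "f \<star> e = h" using bracket_anti[of e f] triple by simp
  obtain r s where rs: "a = r * r" "c = s * s" using sqrt by metis
  then have "r \<noteq> 0 \<or> s \<noteq> 0" using ac by auto
  then obtain x y where xy: "x * r + y * s = 1"
    by (metis add.right_neutral add_0 left_inverse mult_zero_left)
  define e' where "e' = x \<cdot> e + y \<cdot> f"
  define f' where "f' = s \<cdot> e + r \<cdot> f"
  define t where "t = z + (r * s) \<cdot> h"
  have he: "h \<star> e' = e'" and hf: "h \<star> f' = f'" and th: "t \<star> h = 0"
    by (simp_all add: e'_def f'_def t_def bracket_linear bracket_self triple z)
  have ef: "e' \<star> f' = h"
  proof -
    have "e' \<star> f' = (x * r + y * s) \<cdot> h"
      by (simp add: e'_def f'_def bracket_linear bracket_self triple fe scale_left_distrib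
          ac_simps)
    then show ?thesis using xy by simp
  qed
  have te: "t \<star> e' = f'"
  proof -
    have "t \<star> e' = (x * r + y * s) \<cdot> f'"
      by (simp add: e'_def f'_def t_def bracket_linear bracket_self triple z rs
          scale_left_distrib scale_right_distrib distrib_left ac_simps)
    then show ?thesis using xy by simp
  qed
  have tf: "t \<star> f' = 0"
    by (simp add: f'_def t_def bracket_linear bracket_self triple z rs scale_right_distrib ac_simps)
  have "span {e', h, f', t} = G"
  proof
    let ?V = "span {e', h, f', t}"
    show "?V \<subseteq> G"
      by (intro span_minimal) (simp_all add: subspace_carrier e'_def f'_def t_def)
    have V: "e' \<in> ?V" "h \<in> ?V" "f' \<in> ?V" "t \<in> ?V" by (simp_all add: span_base)
    have "r \<cdot> e' + y \<cdot> f' = (x * r + y * s) \<cdot> e" "s \<cdot> e' + x \<cdot> f' = (x * r + y * s) \<cdot> f"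
      by (simp_all add: e'_def f'_def scale_left_distrib scale_right_distrib ac_simps)
    then have "e = r \<cdot> e' + y \<cdot> f'" "f = s \<cdot> e' + x \<cdot> f'" using xy by simp_all
    then have ef: "e \<in> ?V" "f \<in> ?V" using V by (metis span_comb)+
    have "z = t - (r * s) \<cdot> h" by (simp only: t_def add_diff_cancel_right')
    also have "\<dots> \<in> ?V" using V by (intro span_diff span_scale)
    finally show "G \<subseteq> ?V" unfolding G[symmetric] using V ef by (intro span_minimal) simp_all
  qed
  then show ?thesis using he hf ef th te tf by (rule that)
qed

end

section \<open>Isomorphisms with the model algebras\<close>

text \<open>
  The isomorphism is specified by its inverse, the map that sends coordinates to the linear
  combination of the chosen basis; this avoids coordinate functions on the abstract side.
\<close>

lemma lie_isomorphicI:
  fixes g :: "'w::ab_group_add \<Rightarrow> 'v::ab_group_add"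
  assumes closed: "\<And>a b. a \<in> lie_carrier M \<Longrightarrow> b \<in> lie_carrier M \<Longrightarrow> a + b \<in> lie_carrier M"
    "\<And>a b. a \<in> lie_carrier M \<Longrightarrow> b \<in> lie_carrier M \<Longrightarrow> a - b \<in> lie_carrier M"
    "\<And>c a. a \<in> lie_carrier M \<Longrightarrow> lie_scale M c a \<in> lie_carrier M"
    "\<And>a b. a \<in> lie_carrier M \<Longrightarrow> b \<in> lie_carrier M \<Longrightarrow> lie_bracket M a b \<in> lie_carrier M"
    and img: "g ` lie_carrier M = lie_carrier L"
    and ker: "\<And>a. a \<in> lie_carrier M \<Longrightarrow> g a = 0 \<Longrightarrow> a = 0"
    and add: "\<And>a b. a \<in> lie_carrier M \<Longrightarrow> b \<in> lie_carrier M \<Longrightarrow> g (a + b) = g a + g b"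
    and scale: "\<And>c a. a \<in> lie_carrier M \<Longrightarrow> g (lie_scale M c a) = lie_scale L c (g a)"
    and bracket: "\<And>a b. a \<in> lie_carrier M \<Longrightarrow> b \<in> lie_carrier M \<Longrightarrow>
      g (lie_bracket M a b) = lie_bracket L (g a) (g b)"
  shows "lie_isomorphic L M"
proof -
  let ?f = "inv_into (lie_carrier M) g"
  have inj: "inj_on g (lie_carrier M)"
  proof (rule inj_onI)
    fix a b assume ab: "a \<in> lie_carrier M" "b \<in> lie_carrier M" "g a = g b"
    then have "g a = g (a - b) + g b" using add[of "a - b" b] closed by simp
    then show "a = b" using ab ker[of "a - b"] closed by simp
  qed
  have f: "?f (g a) = a" if "a \<in> lie_carrier M" for a
    using inv_into_f_f[OF inj that] .
  have bij: "bij_betw ?f (lie_carrier L) (lie_carrier M)"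
    using inj img by (intro bij_betw_inv_into) (simp add: bij_betw_def)
  show ?thesis
    unfolding lie_isomorphic_def img[symmetric]
  proof (intro exI[of _ ?f] conjI ballI allI)
    show "bij_betw ?f (g ` lie_carrier M) (lie_carrier M)" using bij img by simp
  qed (auto simp: f closed simp flip: add scale bracket)
qed

text \<open>
  The triple corresponds to the matrix units \<open>E\<^sub>1\<^sub>2\<close>, \<open>E\<^sub>2\<^sub>1\<close> and their commutator
  \<open>E\<^sub>1\<^sub>1 - E\<^sub>2\<^sub>2\<close>, and \<open>z\<close> to the identity matrix, so the coefficients of \<open>h\<close> and
  \<open>z\<close> are half the difference and half the sum of the diagonal entries.
\<close>

lemma lie_isomorphic_gl2:
  fixes L :: "('k::field, 'v::ab_group_add) lie_alg"
  assumes "lie_algebra L" and dim: "lie_dim L = 4" and two: "(2 :: 'k) \<noteq> 0"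
    and span: "module.span (lie_scale L) {e, h, f, z} = lie_carrier L"
    and he: "lie_bracket L h e = lie_scale L 2 e" and hf: "lie_bracket L h f = lie_scale L (- 2) f"
    and ef: "lie_bracket L e f = h"
    and z: "lie_bracket L z e = 0" "lie_bracket L z h = 0" "lie_bracket L z f = 0"
  shows "lie_isomorphic L (gl2 :: ('k, 'k ^ 2 ^ 2) lie_alg)"
proof -
  interpret lie_algebra L by fact
  note span = span[folded span_def]
  have [simp]: "e \<in> G" "h \<in> G" "f \<in> G" "z \<in> G"
    unfolding span[symmetric] by (simp_all add: span_base)
  have dim4: "4 \<le> dim (span {e, h, f, z})" using dim span by (simp add: lie_dim_def)
  define g :: "'k ^ 2 ^ 2 \<Rightarrow> 'v" where "g = (\<lambda>A. (A $ 1 $ 2) \<cdot> e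
    + ((A $ 1 $ 1 - A $ 2 $ 2) / 2) \<cdot> h + (A $ 2 $ 1) \<cdot> f + ((A $ 1 $ 1 + A $ 2 $ 2) / 2) \<cdot> z)"
  have half: "(x + y) / 2 + (x - y) / 2 = x" "(x + y) / 2 - (x - y) / 2 = y" for x y :: 'k
  proof -
    have "(4 :: 'k) = 2 * 2" by simp
    then have "(4 :: 'k) \<noteq> 0" using two by (metis mult_eq_0_iff)
    then show "(x + y) / 2 + (x - y) / 2 = x" "(x + y) / 2 - (x - y) / 2 = y"
      using two by (simp_all add: field_simps)
  qed
  show ?thesis
  proof (rule lie_isomorphicI[where g = g])
    show "g ` lie_carrier gl2 = G"
    proof
      show "g ` lie_carrier gl2 \<subseteq> G" by (auto simp: g_def)
      show "G \<subseteq> g ` lie_carrier gl2"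
      proof
        fix x assume "x \<in> G"
        then obtain \<alpha> \<beta> \<gamma> \<delta> where x: "x = \<alpha> \<cdot> e + \<beta> \<cdot> h + \<gamma> \<cdot> f + \<delta> \<cdot> z"
          unfolding span[symmetric] in_span4 by blast
        have "x = g (vector [vector [\<delta> + \<beta>, \<alpha>], vector [\<gamma>, \<delta> - \<beta>]])"
          using two by (simp add: g_def x flip: mult_2)
        then show "x \<in> g ` lie_carrier gl2" by (simp add: gl2_def)
      qed
    qed
    show "A = 0" if "g A = 0" for A
    proof -
      have 0: "A $ 1 $ 2 = 0" "(A $ 1 $ 1 - A $ 2 $ 2) / 2 = 0" "A $ 2 $ 1 = 0"
        "(A $ 1 $ 1 + A $ 2 $ 2) / 2 = 0"
        using independent4_of_dim[OF dim4 that[unfolded g_def]] by simp_all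
      then have "A $ 1 $ 1 = 0" "A $ 2 $ 2 = 0"
        using half[of "A $ 1 $ 1" "A $ 2 $ 2"] unfolding 0(2,4) by simp_all
      then show ?thesis using 0 by (simp add: vec_eq_iff forall_2)
    qed
    show "g (A + B) = g A + g B" for A B
    proof -
      have "(A + B) $ i $ j = A $ i $ j + B $ i $ j" for i j by simp
      moreover have "(a + a' - (b + b')) / 2 = (a - b) / 2 + (a' - b') / 2"
        "(a + a' + (b + b')) / 2 = (a + b) / 2 + (a' + b') / 2" for a b a' b' :: 'k
        by (simp_all add: add_divide_distrib diff_divide_distrib)
      ultimately show ?thesis
        by (simp only: g_def scale_left_distrib ac_simps)
    qed
    show "g (lie_scale gl2 c A) = c \<cdot> g A" for c A
    proof -
      have "lie_scale gl2 c A $ i $ j = c * A $ i $ j" for i j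
        by (simp add: gl2_def map_matrix_def)
      then show ?thesis
        by (simp add: g_def scale_right_distrib flip: right_diff_distrib distrib_left)
    qed
    show "g (lie_bracket gl2 A B) = g A \<star> g B" for A B
    proof -
      have comp: "lie_bracket gl2 A B $ i $ j =
        A $ i $ 1 * B $ 1 $ j + A $ i $ 2 * B $ 2 $ j - (B $ i $ 1 * A $ 1 $ j + B $ i $ 2 * A $ 2 $ j)" for i j
        by (simp add: gl2_def matrix_matrix_mult_def sum_2)
      define a b where "a = (A $ 1 $ 1 - A $ 2 $ 2) / 2" and "b = (B $ 1 $ 1 - B $ 2 $ 2) / 2"
      have a2: "2 * a = A $ 1 $ 1 - A $ 2 $ 2" and b2: "2 * b = B $ 1 $ 1 - B $ 2 $ 2"
        using two by (simp_all add: a_def b_def)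
      have "g A \<star> g B = (2 * (a * B $ 1 $ 2 - A $ 1 $ 2 * b)) \<cdot> e
        + (A $ 1 $ 2 * B $ 2 $ 1 - A $ 2 $ 1 * B $ 1 $ 2) \<cdot> h
        + (2 * (A $ 2 $ 1 * b - a * B $ 2 $ 1)) \<cdot> f + 0 \<cdot> z"
      proof -
        have "e \<star> h = (- 2) \<cdot> e" "f \<star> e = - h"
          using he ef bracket_anti[of h e] bracket_anti[of e f] by simp_all
        then show ?thesis
          unfolding g_def a_def[symmetric] b_def[symmetric]
          by (subst bracket_comb4)
            (simp_all add: z hf ef scale_left_diff_distrib scale_right_diff_distrib algebra_simps)
      qed
      also have "2 * (a * B $ 1 $ 2 - A $ 1 $ 2 * b) = lie_bracket gl2 A B $ 1 $ 2"
      proof -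
        have "2 * (a * B $ 1 $ 2 - A $ 1 $ 2 * b) = (2 * a) * B $ 1 $ 2 - A $ 1 $ 2 * (2 * b)"
          by (simp add: algebra_simps)
        then show ?thesis unfolding a2 b2 comp by (simp add: algebra_simps)
      qed
      also have "2 * (A $ 2 $ 1 * b - a * B $ 2 $ 1) = lie_bracket gl2 A B $ 2 $ 1"
      proof -
        have "2 * (A $ 2 $ 1 * b - a * B $ 2 $ 1) = A $ 2 $ 1 * (2 * b) - (2 * a) * B $ 2 $ 1"
          by (simp add: algebra_simps)
        then show ?thesis unfolding a2 b2 comp by (simp add: algebra_simps)
      qed
      also have "A $ 1 $ 2 * B $ 2 $ 1 - A $ 2 $ 1 * B $ 1 $ 2 =
          (lie_bracket gl2 A B $ 1 $ 1 - lie_bracket gl2 A B $ 2 $ 2) / 2"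
      proof -
        have "lie_bracket gl2 A B $ 1 $ 1 - lie_bracket gl2 A B $ 2 $ 2 =
            2 * (A $ 1 $ 2 * B $ 2 $ 1 - A $ 2 $ 1 * B $ 1 $ 2)"
          unfolding comp by (simp add: algebra_simps)
        then show ?thesis using two by simp
      qed
      also have "0 = (lie_bracket gl2 A B $ 1 $ 1 + lie_bracket gl2 A B $ 2 $ 2) / 2"
        unfolding comp by (simp add: algebra_simps)
      finally show ?thesis by (simp only: g_def)
    qed
  qed (simp_all add: gl2_def)
qed

lemma witt_2_simps:
  "lie_carrier (witt 2 :: ('k::field, nat \<Rightarrow> 'k) lie_alg) = dp_carrier 2"
  "lie_scale (witt 2 :: ('k, nat \<Rightarrow> 'k) lie_alg) c a = (\<lambda>r. c * a r)"
  by (simp_all add: witt_def)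

text \<open>
  In the basis \<open>\<partial>, x\<partial>, x\<^sup>(\<^sup>2\<^sup>)\<partial>, x\<^sup>(\<^sup>3\<^sup>)\<partial>\<close> all structure constants are \<open>0\<close> or \<open>1\<close> up to sign.
  The coefficient of \<open>x\<^sup>(\<^sup>3\<^sup>)\<partial>\<close> in a bracket is \<open>2 (a\<^sub>1 b\<^sub>3 - a\<^sub>3 b\<^sub>1) = 0\<close>, so the derived algebra
  is proper.
\<close>

lemma witt_2_bracket:
  fixes a b :: "nat \<Rightarrow> 'k::field"
  assumes char: "CHAR('k) = 2" and ab: "a \<in> dp_carrier 2" "b \<in> dp_carrier 2"
  shows "lie_bracket (witt 2) a b = (\<lambda>m. if m = 0 then a 0 * b 1 - a 1 * b 0
    else if m = 1 then a 0 * b 2 - a 2 * b 0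
    else if m = 2 then a 0 * b 3 - a 3 * b 0 + (a 1 * b 2 - a 2 * b 1) else 0)"
proof -
  have two: "(2 :: 'k) = 0" using of_nat_CHAR[where 'a = 'k] char by simp
  have three: "(3 :: 'k) = 1"
    using two by (metis add.left_neutral numeral_Bit1 numeral_One one_add_one)
  have zero: "a 4 = 0" "b 4 = 0" using ab char by (auto simp: dp_carrier_def)
  have *: "x + x = 0" for x :: 'k using two by (metis mult_2 mult_zero_left)
  show ?thesis
  proof
    fix m :: nat
    consider "m = 0" | "m = 1" | "m = 2" | "m = 3" | "m \<ge> 4" by linarith
    then show "lie_bracket (witt 2) a b m = (if m = 0 then a 0 * b 1 - a 1 * b 0
      else if m = 1 then a 0 * b 2 - a 2 * b 0
      else if m = 2 then a 0 * b 3 - a 3 * b 0 + (a 1 * b 2 - a 2 * b 1) else 0)"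
    proof cases
      case 3
      then show ?thesis
        by (simp add: witt_def dp_mult_def dp_deriv_def char eval_nat_numeral atMost_Suc)
    next
      case 4
      then show ?thesis
        using zero
        by (simp add: witt_def dp_mult_def dp_deriv_def char eval_nat_numeral atMost_Suc)
          (simp add: two three algebra_simps *)
    qed (simp_all add: witt_def dp_mult_def dp_deriv_def char eval_nat_numeral atMost_Suc
          algebra_simps)
  qed
qed

lemma bracket_witt_in_carrier:
  assumes "CHAR('k::field) = 2" "a \<in> dp_carrier 2" "b \<in> dp_carrier 2"
  shows "lie_bracket (witt 2) a b \<in> (dp_carrier 2 :: (nat \<Rightarrow> 'k) set)"
  unfolding witt_2_bracket[OF assms] dp_carrier_def using assms(1) by simp

lemma lie_carrier_derived_witt_2:
  assumes char: "CHAR('k::field) = 2"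
  shows "lie_carrier (lie_derived (witt 2 :: ('k, nat \<Rightarrow> 'k) lie_alg)) = {a. \<forall>m\<ge>3. a m = 0}"
proof -
  let ?W = "witt 2 :: ('k, nat \<Rightarrow> 'k) lie_alg"
  interpret vector_space "\<lambda>(c :: 'k) (a :: nat \<Rightarrow> 'k) r. c * a r"
    by unfold_locales (auto simp: fun_eq_iff algebra_simps)
  have scale: "lie_scale ?W = (\<lambda>c a r. c * a r)" by (simp add: witt_def)
  let ?B = "{lie_bracket ?W a b |a b. a \<in> dp_carrier 2 \<and> b \<in> dp_carrier 2}"
  have "lie_carrier (lie_derived ?W) = span ?B"
    by (simp add: lie_derived_def lie_restrict_def scale witt_2_simps)
  also have "\<dots> = {a. \<forall>m\<ge>3. a m = 0}"
  proof
    have "subspace {a :: nat \<Rightarrow> 'k. \<forall>m\<ge>3. a m = 0}"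
      by (rule subspaceI) auto
    moreover have "?B \<subseteq> {a. \<forall>m\<ge>3. a m = 0}"
      by (auto simp: witt_2_bracket[OF char])
    ultimately show "span ?B \<subseteq> {a. \<forall>m\<ge>3. a m = 0}" by (intro span_minimal)
    have basis: "dp_basis i \<in> (dp_carrier 2 :: (nat \<Rightarrow> 'k) set)" if "i < 4" for i
      using that char by (auto simp: dp_carrier_def dp_basis_def)
    have brackets: "lie_bracket ?W (dp_basis 0) (dp_basis 1) = dp_basis 0"
      "lie_bracket ?W (dp_basis 0) (dp_basis 2) = dp_basis 1"
      "lie_bracket ?W (dp_basis 1) (dp_basis 2) = dp_basis 2"
      by (simp_all add: witt_2_bracket[OF char] basis) (auto simp: dp_basis_def fun_eq_iff)
    have in_span: "dp_basis 0 \<in> span ?B" "dp_basis 1 \<in> span ?B" "dp_basis 2 \<in> span ?B"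
    proof -
      have "lie_bracket ?W (dp_basis i) (dp_basis j) \<in> span ?B" if "i < 4" "j < 4" for i j
        using basis that by (intro span_base) blast
      from this[of 0 1] this[of 0 2] this[of 1 2]
      show "dp_basis 0 \<in> span ?B" "dp_basis 1 \<in> span ?B" "dp_basis 2 \<in> span ?B"
        unfolding brackets by simp_all
    qed
    show "{a. \<forall>m\<ge>3. a m = 0} \<subseteq> span ?B"
    proof
      fix a :: "nat \<Rightarrow> 'k" assume a: "a \<in> {a. \<forall>m\<ge>3. a m = 0}"
      have "a = (\<lambda>r. a 0 * dp_basis 0 r) + (\<lambda>r. a 1 * dp_basis 1 r) + (\<lambda>r. a 2 * dp_basis 2 r)"
      proof
        fix m :: nat
        consider "m = 0" | "m = 1" | "m = 2" | "m \<ge> 3" by linarith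
        then show "a m = ((\<lambda>r. a 0 * dp_basis 0 r) + (\<lambda>r. a 1 * dp_basis 1 r)
            + (\<lambda>r. a 2 * dp_basis 2 r)) m"
          by cases (use a in \<open>auto simp: dp_basis_def\<close>)
      qed
      also have "\<dots> \<in> span ?B" by (intro span_add span_scale in_span)
      finally show "a \<in> span ?B" .
    qed
  qed
  finally show ?thesis .
qed

text \<open>
  The basis \<open>e, h, f, t\<close> corresponds to \<open>\<partial>, x\<partial>, x\<^sup>(\<^sup>2\<^sup>)\<partial>, x\<^sup>(\<^sup>3\<^sup>)\<partial>\<close>; in characteristic two
  the signs in the bracket relations do not matter.
\<close>

lemma lie_isomorphic_witt_2:
  fixes L :: "('k::field, 'v::ab_group_add) lie_alg"
  assumes "lie_algebra L" and dim: "lie_dim L = 4" and char: "CHAR('k) = 2"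
    and span: "module.span (lie_scale L) {e, h, f, t} = lie_carrier L"
    and triple: "lie_bracket L h e = e" "lie_bracket L h f = f" "lie_bracket L e f = h"
    and t: "lie_bracket L t h = 0" "lie_bracket L t e = f" "lie_bracket L t f = 0"
  shows "lie_isomorphic L (witt 2 :: ('k, nat \<Rightarrow> 'k) lie_alg)"
proof -
  interpret lie_algebra L by fact
  have two: "(2 :: 'k) = 0" using of_nat_CHAR[where 'a = 'k] char by simp
  note span = span[folded span_def]
  have [simp]: "e \<in> G" "h \<in> G" "f \<in> G" "t \<in> G"
    unfolding span[symmetric] by (simp_all add: span_base)
  have dim4: "4 \<le> dim (span {e, h, f, t})" using dim span by (simp add: lie_dim_def)
  define g :: "(nat \<Rightarrow> 'k) \<Rightarrow> 'v" where "g = (\<lambda>a. a 0 \<cdot> e + a 1 \<cdot> h + a 2 \<cdot> f + a 3 \<cdot> t)"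
  show ?thesis
  proof (rule lie_isomorphicI[where g = g])
    show "g ` lie_carrier (witt 2) = G"
    proof
      show "g ` lie_carrier (witt 2) \<subseteq> G" by (auto simp: g_def)
      show "G \<subseteq> g ` lie_carrier (witt 2)"
      proof
        fix x assume "x \<in> G"
        then obtain \<alpha> \<beta> \<gamma> \<delta> where x: "x = \<alpha> \<cdot> e + \<beta> \<cdot> h + \<gamma> \<cdot> f + \<delta> \<cdot> t"
          unfolding span[symmetric] in_span4 by blast
        let ?a = "\<lambda>m::nat. if m = 0 then \<alpha> else if m = 1 then \<beta> else if m = 2 then \<gamma>
          else if m = 3 then \<delta> else 0"
        have "x = g ?a" by (simp add: g_def x)
        moreover have "?a \<in> lie_carrier (witt 2)" by (simp add: witt_2_simps dp_carrier_def char)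
        ultimately show "x \<in> g ` lie_carrier (witt 2)" by blast
      qed
    qed
    show "a = 0" if "a \<in> lie_carrier (witt 2)" "g a = 0" for a
    proof
      fix m :: nat
      consider "m = 0" | "m = 1" | "m = 2" | "m = 3" | "m \<ge> 4" by linarith
      then show "a m = 0 m"
        using independent4_of_dim[OF dim4 that(2)[unfolded g_def]] that(1) char
        by cases (auto simp: witt_2_simps dp_carrier_def)
    qed
    show "g (lie_bracket (witt 2) a b) = g a \<star> g b"
      if "a \<in> lie_carrier (witt 2)" "b \<in> lie_carrier (witt 2)" for a b
    proof -
      note [simp] = char_2_simps[OF two]
      have "e \<star> h = e" "f \<star> e = h"
        using triple bracket_anti[of h e] bracket_anti[of e f] by simp_all
      moreover have diff: "x - y = x + y" for x y :: 'k
        by (simp only: diff_conv_add_uminus char_2_simps(4)[OF two])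
      ultimately show ?thesis
        using that
        unfolding g_def
        by (subst bracket_comb4)
          (simp_all add: witt_2_simps witt_2_bracket[OF char] diff two triple t
            scale_left_distrib ac_simps)
    qed
  qed (auto simp: witt_2_simps bracket_witt_in_carrier[OF char] g_def scale_left_distrib
      scale_right_distrib ac_simps, auto simp: dp_carrier_def)
qed

lemma lie_isomorphic_derived_witt_2:
  fixes L :: "('k::field, 'v::ab_group_add) lie_alg"
  assumes "lie_algebra L" and dim: "lie_dim L = 3" and char: "CHAR('k) = 2"
    and span: "module.span (lie_scale L) {e, h, f} = lie_carrier L"
    and triple: "lie_bracket L h e = e" "lie_bracket L h f = f" "lie_bracket L e f = h"
  shows "lie_isomorphic L (lie_derived (witt 2 :: ('k, nat \<Rightarrow> 'k) lie_alg))"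
proof -
  interpret lie_algebra L by fact
  have two: "(2 :: 'k) = 0" using of_nat_CHAR[where 'a = 'k] char by simp
  let ?M = "lie_derived (witt 2 :: ('k, nat \<Rightarrow> 'k) lie_alg)"
  note carrier = lie_carrier_derived_witt_2[OF char]
  have M: "lie_scale ?M c a = (\<lambda>r. c * a r)" "lie_bracket ?M = lie_bracket (witt 2)" for c a
    by (simp_all add: lie_derived_def lie_restrict_def witt_def)
  have sub: "a \<in> dp_carrier 2" if "a \<in> lie_carrier ?M" for a
    using that by (simp add: carrier dp_carrier_def char)
  note span = span[folded span_def]
  have [simp]: "e \<in> G" "h \<in> G" "f \<in> G"
    unfolding span[symmetric] by (simp_all add: span_base)
  have dim3: "3 \<le> dim (span {e, h, f})" using dim span by (simp add: lie_dim_def)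
  define g :: "(nat \<Rightarrow> 'k) \<Rightarrow> 'v" where "g = (\<lambda>a. a 0 \<cdot> e + a 1 \<cdot> h + a 2 \<cdot> f)"
  show ?thesis
  proof (rule lie_isomorphicI[where g = g])
    show "g ` lie_carrier ?M = G"
    proof
      show "g ` lie_carrier ?M \<subseteq> G" by (auto simp: g_def)
      show "G \<subseteq> g ` lie_carrier ?M"
      proof
        fix x assume "x \<in> G"
        then obtain \<alpha> \<beta> \<gamma> where x: "x = \<alpha> \<cdot> e + \<beta> \<cdot> h + \<gamma> \<cdot> f"
          unfolding span[symmetric] in_span3 by blast
        let ?a = "\<lambda>m::nat. if m = 0 then \<alpha> else if m = 1 then \<beta> else if m = 2 then \<gamma> else 0"
        have "x = g ?a" by (simp add: g_def x)
        moreover have "?a \<in> lie_carrier ?M" by (simp add: carrier)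
        ultimately show "x \<in> g ` lie_carrier ?M" by blast
      qed
    qed
    show "a = 0" if "a \<in> lie_carrier ?M" "g a = 0" for a
    proof
      fix m :: nat
      consider "m = 0" | "m = 1" | "m = 2" | "m \<ge> 3" by linarith
      then show "a m = 0 m"
        using independent3_of_dim[OF dim3 that(2)[unfolded g_def]] that(1)
        by cases (auto simp: carrier)
    qed
    show "g (lie_bracket ?M a b) = g a \<star> g b"
      if "a \<in> lie_carrier ?M" "b \<in> lie_carrier ?M" for a b
    proof -
      note [simp] = char_2_simps[OF two]
      have "e \<star> h = e" "f \<star> e = h"
        using triple bracket_anti[of h e] bracket_anti[of e f] by simp_all
      moreover have diff: "x - y = x + y" for x y :: 'k
        by (simp only: diff_conv_add_uminus char_2_simps(4)[OF two])
      moreover have "a 3 = 0" "b 3 = 0" using that by (simp_all add: carrier)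
      ultimately show ?thesis
        using sub[OF that(1)] sub[OF that(2)]
        unfolding g_def
        by (subst bracket_comb3)
          (simp_all add: M witt_2_bracket[OF char] diff two triple scale_left_distrib ac_simps)
    qed
    show "lie_bracket ?M a b \<in> lie_carrier ?M"
      if "a \<in> lie_carrier ?M" "b \<in> lie_carrier ?M" for a b
      unfolding M carrier witt_2_bracket[OF char sub[OF that(1)] sub[OF that(2)]] by simp
  qed (auto simp: carrier M g_def scale_left_distrib scale_right_distrib ac_simps)
qed

section \<open>The classification\<close>

lemma obtain_square_root_char_2:
  fixes x :: "'k::{field,finite}"
  assumes "(2 :: 'k) = 0"
  obtains y where "x = y * y"
proof -
  have "inj (\<lambda>y :: 'k. y * y)"
  proof (rule injI)
    fix y z :: 'k assume "y * y = z * z"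
    moreover have "z + z = 0" using assms by (metis mult_2 mult_zero_left)
    then have "- z = z" by (rule minus_unique)
    ultimately show "y = z" using square_eq_iff[of y z] by auto
  qed
  then have "surj (\<lambda>y :: 'k. y * y)" by (simp add: finite_UNIV_inj_surj)
  then show ?thesis using that by (metis surjD)
qed

theorem theorem4p1:
  fixes L :: "('k::{field,finite}, 'v::ab_group_add) lie_alg" and p :: nat
  assumes "lie_algebra L"
    and "lie_dim L = 4"
    and "\<not> lie_solvable L"
    and "p = CHAR('k)"
  shows "(p = 2 \<longrightarrow>
            lie_isomorphic L (witt 2 :: ('k, nat \<Rightarrow> 'k) lie_alg) \<or>
            (\<exists>I. lie_direct_sum L I (lie_center L) \<and>
                 lie_isomorphic (lie_restrict L I)
                   (lie_derived (witt 2 :: ('k, nat \<Rightarrow> 'k) lie_alg)))) \<and>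
         (p \<ge> 3 \<longrightarrow> lie_isomorphic L (gl2 :: ('k, 'k ^ 2 ^ 2) lie_alg))"
proof -
  interpret lie_algebra L by fact
  interpret D: lie_algebra "lie_derived L"
    rewrites "lie_scale (lie_derived L) = lie_scale L"
      and "lie_bracket (lie_derived L) = lie_bracket L"
    by (simp_all add: lie_algebra_derived)
  have dim: "dim G = 4" using assms(2) by (simp add: lie_dim_def)
  note perfect = derived_perfect_of_dim_3[OF dim assms(3)]
  show ?thesis
  proof (intro conjI impI)
    assume "p = 2"
    then have char: "CHAR('k) = 2" using assms(4) by simp
    then have two: "(2 :: 'k) = 0" using of_nat_CHAR[where 'a = 'k] by simp
    note neg = char_2_simps[OF two]
    have sqrt: "\<exists>y. x = y * y" for x :: 'k
      by (rule obtain_square_root_char_2[OF two]) blast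
    obtain e h f where D: "span {e, h, f} = D"
      and triple: "h \<star> e = e" "h \<star> f = f" "e \<star> f = h"
      by (rule D.obtain_triple_char_2[OF perfect two sqrt])
    obtain t where "span {e, h, f, t} = G"
      by (rule obtain_complement[OF dim perfect(1) D[symmetric]])
    then obtain z a c where G: "span {e, h, f, z} = G"
      and z: "z \<star> h = 0" "z \<star> e = a \<cdot> f" "z \<star> f = c \<cdot> e"
      by (rule obtain_reduced_derivation[OF perfect(1) D[symmetric], where \<tau> = 1])
        (use triple in \<open>simp_all add: neg\<close>)
    show "lie_isomorphic L (witt 2 :: ('k, nat \<Rightarrow> 'k) lie_alg) \<or>
      (\<exists>I. lie_direct_sum L I (lie_center L) \<and> lie_isomorphic (lie_restrict L I)
        (lie_derived (witt 2 :: ('k, nat \<Rightarrow> 'k) lie_alg)))"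
    proof (cases "a = 0 \<and> c = 0")
      case False
      then have "a \<noteq> 0 \<or> c \<noteq> 0" by blast
      then obtain e' f' t where "span {e', h, f', t} = G" "h \<star> e' = e'" "h \<star> f' = f'"
        "e' \<star> f' = h" "t \<star> h = 0" "t \<star> e' = f'" "t \<star> f' = 0"
        by (rule obtain_outer_square_derivation[OF two sqrt G triple z])
      then have "lie_isomorphic L (witt 2 :: ('k, nat \<Rightarrow> 'k) lie_alg)"
        by (rule lie_isomorphic_witt_2[OF assms(1,2) char])
      then show ?thesis ..
    next
      case True
      have [simp]: "e \<in> G" "h \<in> G" "f \<in> G" "z \<in> G"
        unfolding G[symmetric] by (simp_all add: span_base)
      have dim4: "4 \<le> dim (span {e, h, f, z})" using dim G by simp
      have bra: "e \<star> h = e" "f \<star> e = h"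
        using triple bracket_anti[of h e] bracket_anti[of e f] neg by simp_all
      have expand: "\<exists>\<alpha> \<beta> \<gamma> \<delta>. x = \<alpha> \<cdot> e + \<beta> \<cdot> h + \<gamma> \<cdot> f + \<delta> \<cdot> z" if "x \<in> G" for x
        using that unfolding G[symmetric] in_span4 .
      have center: "lie_center L = span {z}"
      proof
        show "lie_center L \<subseteq> span {z}"
        proof
          fix x assume x: "x \<in> lie_center L"
          then have "x \<in> G" by (simp add: lie_center_def)
          then obtain \<alpha> \<beta> \<gamma> \<delta> where xe: "x = \<alpha> \<cdot> e + \<beta> \<cdot> h + \<gamma> \<cdot> f + \<delta> \<cdot> z"
            using expand by blast
          have "x \<star> h = 0" "x \<star> e = 0" using x by (simp_all add: lie_center_def)
          moreover have "f \<star> h = f" using triple bracket_anti[of h f] neg by simp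
          ultimately have "\<alpha> \<cdot> e + 0 \<cdot> h + \<gamma> \<cdot> f + 0 \<cdot> z = 0" "\<beta> \<cdot> e + \<gamma> \<cdot> h + 0 \<cdot> f + 0 \<cdot> z = 0"
            by (simp_all add: xe bracket_linear bracket_self bra triple z True)
          from independent4_of_dim[OF dim4 this(1)] independent4_of_dim[OF dim4 this(2)]
          show "x \<in> span {z}" using xe by (auto simp: span_singleton)
        qed
        have "z \<star> x = 0" if "x \<in> G" for x
          using expand[OF that] by (auto simp: bracket_linear bracket_self z True)
        then show "span {z} \<subseteq> lie_center L"
          by (auto simp: span_singleton lie_center_def bracket_linear)
      qed
      have "lie_direct_sum L D (lie_center L)"
        unfolding lie_direct_sum_def
      proof (intro conjI)
        show "lie_ideal L D"
          using D_subset subspace_D bracket_in_D by (auto simp: lie_ideal_def subset_iff)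
        have "z \<star> x = 0 \<and> x \<star> z = 0" if "x \<in> G" for x
          using center that bracket_anti[of z x] span_base[of z "{z}"] by (auto simp: lie_center_def)
        then show "lie_ideal L (lie_center L)"
          unfolding center
          by (auto simp: lie_ideal_def span_singleton bracket_linear intro: exI[of _ 0])
            (simp_all flip: span_singleton)
        show "D \<inter> lie_center L = {0}"
        proof
          show "D \<inter> lie_center L \<subseteq> {0}"
          proof
            fix x assume x: "x \<in> D \<inter> lie_center L"
            then obtain \<alpha> \<beta> \<gamma> \<delta> where "x = \<alpha> \<cdot> e + \<beta> \<cdot> h + \<gamma> \<cdot> f" and xz: "x = \<delta> \<cdot> z"
              unfolding center D[symmetric] in_span3 Int_iff in_span_singleton by blast
            then have "\<alpha> \<cdot> e + \<beta> \<cdot> h + \<gamma> \<cdot> f + (- \<delta>) \<cdot> z = 0" by simp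
            from independent4_of_dim(4)[OF dim4 this] show "x \<in> {0}" using xz by simp
          qed
          show "{0} \<subseteq> D \<inter> lie_center L"
            unfolding center using subspace_0[OF subspace_D] by (simp add: span_zero)
        qed
        have "{x + y |x y. x \<in> D \<and> y \<in> lie_center L} = span ({e, h, f} \<union> {z})"
          unfolding center D[symmetric] span_Un ..
        also have "\<dots> = G" unfolding G[symmetric] by (rule arg_cong[of _ _ span]) blast
        finally show "G = {x + y |x y. x \<in> D \<and> y \<in> lie_center L}" by simp
      qed
      moreover have "lie_restrict L D = lie_derived L"
        by (simp add: lie_derived_def lie_restrict_def)
      moreover have "lie_isomorphic (lie_derived L) (lie_derived (witt 2 :: ('k, nat \<Rightarrow> 'k) lie_alg))"
        by (rule lie_isomorphic_derived_witt_2[OF lie_algebra_derived _ char, of e h f])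
          (simp_all add: lie_dim_def perfect D triple)
      ultimately show ?thesis by auto
    qed
  next
    assume "p \<ge> 3"
    have two: "(2 :: 'k) \<noteq> 0"
    proof
      assume "(2 :: 'k) = 0"
      then have "CHAR('k) dvd 2" using of_nat_eq_0_iff_char_dvd[where 'a = 'k, of 2] by simp
      then show False using \<open>p \<ge> 3\<close> assms(4) by (auto dest: dvd_imp_le)
    qed
    have binary: "\<exists>x y. 2 * b * x * y - c * x * x - a * y * y = 1"
      if "b * b - a * c \<noteq> 0" for a b c :: 'k
      using binary_form_represents_one[OF two that] by blast
    obtain e h f where D: "span {e, h, f} = D"
      and triple: "h \<star> e = 2 \<cdot> e" "h \<star> f = (- 2) \<cdot> f" "e \<star> f = h"
      by (rule D.obtain_sl2_triple[OF perfect two binary])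
    obtain t where "span {e, h, f, t} = G"
      by (rule obtain_complement[OF dim perfect(1) D[symmetric]])
    then obtain z a c where G: "span {e, h, f, z} = G"
      and z: "z \<star> h = 0" "z \<star> e = a \<cdot> f" "z \<star> f = c \<cdot> e" "2 * a = 0" "2 * c = 0"
      by (rule obtain_reduced_derivation[OF perfect(1) D[symmetric] _ two triple])
    then have "z \<star> e = 0" "z \<star> f = 0" using two by auto
    then show "lie_isomorphic L (gl2 :: ('k, 'k ^ 2 ^ 2) lie_alg)"
      by (intro lie_isomorphic_gl2[OF assms(1,2) two G triple]) (simp_all add: z)
  qed
qed

end
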